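(* Let $G$ be a transfinite nilpotent profinite group. If every dense subgroup of $G$ is separable, then $G$ is metrizable.
   Context: All topological groups are assumed to be Hausdorff. A profinite group is a totally disconnected compact group. For a compact group $G$ define, by transfinite recursion, $G_0=G$; $G_{\alpha}=\overline{[G,G_\beta]}$ if $\alpha=\beta+1$ is a successor ordinal; and $G_\alpha=\bigcap_{\beta<\alpha}G_\beta$ if $\alpha>0$ is a limit ordinal. Here $[G,G_\beta]$ is the subgroup of $G$ generated by $\{ghg^{-1}h^{-1}: g\in G, h\in G_\beta\}$, and the bar denotes closure in $G$. The compact group $G$ is called transfinite nilpotent if $G_\alpha=\{1\}$ for some ordinal $\alpha$. A topological space is separable if it has a countable (possibly finite) dense subset; subgroups carry the subspace topology. *)

theory Defs
  imports "HOL-Analysis.Analysis" "HOL-Algebra.Generated_Groups"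
begin

locale topological_group = group G for G (structure) and T :: "'a topology" +
  assumes topspace_eq [simp]: "topspace T = carrier G"
    and Hausdorff: "Hausdorff_space T"
    and continuous_mult: "continuous_map (prod_topology T T) T (\<lambda>(x, y). x \<otimes> y)"
    and continuous_inv: "continuous_map T T (\<lambda>x. inv x)"

definition totally_disconnected_space :: "'a topology \<Rightarrow> bool" where
  "totally_disconnected_space T \<longleftrightarrow>
     (\<forall>x\<in>topspace T. connected_component_of_set T x = {x})"

locale compact_group = topological_group +
  assumes compact: "compact_space T"

locale profinite_group = compact_group +
  assumes totally_disconnected: "totally_disconnected_space T"

definition closed_commutator ::
    "('a, 'b) monoid_scheme \<Rightarrow> 'a topology \<Rightarrow> 'a set \<Rightarrow> 'a set" where
  "closed_commutator G T H =
     T closure_of generate G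
       {g \<otimes>\<^bsub>G\<^esub> h \<otimes>\<^bsub>G\<^esub> inv\<^bsub>G\<^esub> g \<otimes>\<^bsub>G\<^esub> inv\<^bsub>G\<^esub> h | g h. g \<in> carrier G \<and> h \<in> H}"

definition is_pred :: "'i rel \<Rightarrow> 'i \<Rightarrow> 'i \<Rightarrow> bool" where
  "is_pred r b a \<longleftrightarrow> b \<in> underS r a \<and> (\<forall>c\<in>underS r a. (c, b) \<in> r)"

text \<open>
  Ordinals are represented by the elements of a well-order \<open>r\<close>, an element \<open>a\<close> standing
  for the order type of \<open>underS r a\<close>. The three branches are the cases \<open>0\<close>,
  successor and limit; see \<open>lower_central_zero\<close>, \<open>lower_central_succ\<close> and
  \<open>lower_central_limit\<close> below.
\<close>

definition lower_central ::
    "('a, 'b) monoid_scheme \<Rightarrow> 'a topology \<Rightarrow> 'i rel \<Rightarrow> 'i \<Rightarrow> 'a set" where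
  "lower_central G T r = wfrec (r - Id) (\<lambda>F a.
     if underS r a = {} then carrier G
     else if \<exists>b. is_pred r b a then closed_commutator G T (F (THE b. is_pred r b a))
     else (\<Inter>b\<in>underS r a. F b))"

text \<open>
  An existential quantifier cannot range over types, so \<open>r\<close> has to live on one fixed type.
  Well-orders on \<open>'a set\<close> are long enough, because the series decreases strictly until it
  becomes stationary; the lemma \<open>transfinite_nilpotentI\<close> below proves that an ordinal
  from any type whatsoever can be used to establish the property.
\<close>

definition transfinite_nilpotent :: "('a, 'b) monoid_scheme \<Rightarrow> 'a topology \<Rightarrow> bool" where
  "transfinite_nilpotent G T \<longleftrightarrow>
     (\<exists>(r :: 'a set rel) a. Well_order r \<and> a \<in> Field r \<and> lower_central G T r a = {\<one>\<^bsub>G\<^esub>})"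

lemma lower_central_unfold:
  fixes G :: "('a, 'b) monoid_scheme" and r :: "'i rel"
  assumes "Well_order r"
  shows "lower_central G T r a =
    (if underS r a = {} then carrier G
     else if \<exists>b. is_pred r b a
       then closed_commutator G T (lower_central G T r (THE b. is_pred r b a))
     else (\<Inter>b\<in>underS r a. lower_central G T r b))"
proof -
  interpret W: wo_rel r using assms by (simp add: wo_rel_def)
  have th: "(THE b. is_pred r b a) \<in> underS r a" if ex: "\<exists>b. is_pred r b a" for a
  proof -
    have "\<exists>!b. is_pred r b a"
      using ex W.ANTISYM unfolding is_pred_def antisym_def by blast
    then show ?thesis by (metis is_pred_def theI')
  qed
  have sub: "b \<in> underS r a \<Longrightarrow> (b, a) \<in> r - Id" for a b
    by (simp add: underS_def)
  let ?F = "\<lambda>F a. if underS r a = {} then carrier G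
     else if \<exists>b. is_pred r b a then closed_commutator G T (F (THE b. is_pred r b a))
     else (\<Inter>b\<in>underS r a. F b)"
  have "adm_wf (r - Id) ?F"
    unfolding adm_wf_def
  proof (intro allI impI)
    fix f g :: "'i \<Rightarrow> 'a set" and x
    assume "\<forall>z. (z, x) \<in> r - Id \<longrightarrow> f z = g z"
    then have eq: "f z = g z" if "z \<in> underS r x" for z
      using sub that by blast
    show "?F f x = ?F g x"
      using eq th[of x] by (auto simp del: INT_iff cong: INF_cong)
  qed
  from wfrec_fixpoint[OF W.WF this] show ?thesis
    unfolding lower_central_def by (rule fun_cong)
qed

lemma lower_central_zero:
  assumes "Well_order r" "underS r a = {}"
  shows "lower_central G T r a = carrier G"
  using assms by (subst lower_central_unfold) auto

lemma lower_central_succ: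
  assumes "Well_order r" and b: "is_pred r b a"
  shows "lower_central G T r a = closed_commutator G T (lower_central G T r b)"
proof -
  interpret W: wo_rel r using assms by (simp add: wo_rel_def)
  have "(THE b. is_pred r b a) = b"
    using b W.ANTISYM unfolding is_pred_def antisym_def by blast
  moreover have "underS r a \<noteq> {}" using b by (auto simp: is_pred_def)
  ultimately show ?thesis
    using b by (subst lower_central_unfold[OF assms(1)]) auto
qed

lemma lower_central_limit:
  assumes "Well_order r" "underS r a \<noteq> {}" "\<nexists>b. is_pred r b a"
  shows "lower_central G T r a = (\<Inter>b\<in>underS r a. lower_central G T r b)"
  using assms by (subst lower_central_unfold) auto

context topological_group
begin

lemma closed_commutator_mono:
  "A \<subseteq> B \<Longrightarrow> closed_commutator G T A \<subseteq> closed_commutator G T B"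
  unfolding closed_commutator_def by (intro closure_of_mono mono_generate) auto

lemma closed_commutator_subset: "closed_commutator G T A \<subseteq> carrier G"
  unfolding closed_commutator_def using closure_of_subset_topspace[of T] by simp

lemma transfinite_nilpotentI:
  fixes r :: "'i rel"
  assumes WO: "Well_order r" and "a \<in> Field r" "lower_central G T r a = {\<one>}"
  shows "transfinite_nilpotent G T"
proof -
  interpret W: wo_rel r using WO by (simp add: wo_rel_def)
  define L where "L = lower_central G T r"
  define C where "C = closed_commutator G T"
  have Cm: "A \<subseteq> B \<Longrightarrow> C A \<subseteq> C B" for A B
    unfolding C_def by (rule closed_commutator_mono)
  have L0: "underS r b = {} \<Longrightarrow> L b = carrier G" for b
    unfolding L_def using WO by (rule lower_central_zero)
  have LS: "is_pred r d b \<Longrightarrow> L b = C (L d)" for b d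
    unfolding L_def C_def using WO by (rule lower_central_succ)
  have LL: "underS r b \<noteq> {} \<Longrightarrow> \<nexists>d. is_pred r d b \<Longrightarrow> L b = (\<Inter>d\<in>underS r b. L d)" for b
    unfolding L_def using WO by (rule lower_central_limit)
  have ind: "P b" if "\<And>b. (\<And>d. d \<in> underS r b \<Longrightarrow> P d) \<Longrightarrow> P b" for P and b :: 'i
    by (rule W.well_order_induct) (use that in \<open>auto simp: underS_def\<close>)
  have CL: "C (L b) \<subseteq> L b" for b
  proof (induction b rule: ind)
    case (1 b)
    consider "underS r b = {}" | d where "is_pred r d b"
      | "underS r b \<noteq> {}" "\<nexists>d. is_pred r d b" by blast
    then show ?case
    proof cases
      case 1
      then show ?thesis using L0 closed_commutator_subset by (simp add: C_def)
    next
      case (2 d)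
      then show ?thesis using 1 Cm LS unfolding is_pred_def by metis
    next
      case 3
      have "C (L b) \<subseteq> L d" if "d \<in> underS r b" for d
      proof -
        have "L b \<subseteq> L d" using LL[OF 3] that by blast
        then show ?thesis using Cm 1[OF that] by blast
      qed
      then show ?thesis using LL[OF 3] by blast
    qed
  qed
  have anti: "L c \<subseteq> L b" if "(b, c) \<in> r" for b c
    using that
  proof (induction c rule: ind)
    case (1 c)
    show ?case
    proof (cases "b = c")
      case False
      then have b: "b \<in> underS r c" using 1(2) by (auto simp: underS_def)
      show ?thesis
      proof (cases "\<exists>d. is_pred r d c")
        case True
        then obtain d where d: "is_pred r d c" by blast
        then have "L d \<subseteq> L b" using 1(1) b unfolding is_pred_def by blast
        then show ?thesis using LS[OF d] CL by blast
      next
        case False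
        then show ?thesis using LL b by blast
      qed
    qed auto
  qed
  define Z where "Z = {b \<in> Field r. L b = {\<one>}}"
  have Z: "Z \<subseteq> Field r" "Z \<noteq> {}" using assms unfolding Z_def L_def by auto
  define m where "m = W.minim Z"
  have m: "m \<in> Field r" "L m = {\<one>}" using W.minim_in[OF Z] by (auto simp: m_def Z_def)
  have mmin: "L b \<noteq> {\<one>}" if "b \<in> underS r m" for b
  proof
    assume "L b = {\<one>}"
    moreover have "b \<in> Field r" using that by (auto simp: underS_def Field_def)
    ultimately have "(m, b) \<in> r" using W.minim_least[OF Z(1)] by (simp add: Z_def m_def)
    then show False using that W.ANTISYM by (auto simp: underS_def antisym_def)
  qed
  have strict: "L c \<noteq> L b" if "b \<in> underS r c" "(c, m) \<in> r" for b c
  proof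
    assume eq: "L c = L b"
    have bF: "b \<in> Field r" "c \<in> aboveS r b" "c \<in> Field r"
      using that by (auto simp: underS_def aboveS_def Field_def)
    have ab: "aboveS r b \<subseteq> Field r" "aboveS r b \<noteq> {}"
      using bF by (auto simp: aboveS_def Field_def)
    define s where "s = W.minim (aboveS r b)"
    have s: "s \<in> aboveS r b" using W.minim_in[OF ab] by (simp add: s_def)
    have sl: "(s, d) \<in> r" if "d \<in> aboveS r b" for d
      using W.minim_least[OF ab(1) that] by (simp add: s_def)
    have pred: "is_pred r b s"
      unfolding is_pred_def
    proof
      show "b \<in> underS r s" using s by (auto simp: underS_def aboveS_def)
      show "\<forall>d\<in>underS r s. (d, b) \<in> r"
      proof
        fix d assume d: "d \<in> underS r s"
        then have dF: "d \<in> Field r" by (auto simp: underS_def Field_def)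
        have "d \<notin> aboveS r b"
          using d sl W.ANTISYM by (auto simp: underS_def antisym_def)
        then show "(d, b) \<in> r"
          using dF bF(1) W.TOTALS by (auto simp: aboveS_def)
      qed
    qed
    have "L c \<subseteq> C (L b)" using anti[OF sl[OF bF(2)]] LS[OF pred] by simp
    then have CLb: "C (L b) = L b" using eq CL by blast
    have const: "L d = L b" if "(b, d) \<in> r" for d
      using that
    proof (induction d rule: ind)
      case (1 d)
      show ?case
      proof (cases "b = d")
        case False
        then have b: "b \<in> underS r d" using 1(2) by (auto simp: underS_def)
        show ?thesis
        proof (cases "\<exists>e. is_pred r e d")
          case True
          then obtain e where e: "is_pred r e d" by blast
          then have "L e = L b" using 1(1) b unfolding is_pred_def by blast
          then show ?thesis using LS[OF e] CLb by simp
        next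
          case False
          have "L b \<subseteq> L e" if "e \<in> underS r d" for e
          proof -
            have "e \<in> Field r" using that by (auto simp: underS_def Field_def)
            then have "(b, e) \<in> r \<or> (e, b) \<in> r" using W.TOTALS bF(1) by blast
            then show ?thesis using 1(1)[OF that] anti by blast
          qed
          moreover have "L d = (\<Inter>e\<in>underS r d. L e)" using LL b False by blast
          ultimately show ?thesis using b by blast
        qed
      qed auto
    qed
    have "(b, m) \<in> r" "b \<noteq> m"
      using that W.TRANS W.ANTISYM by (auto simp: underS_def trans_def antisym_def)
    then show False using const[of m] m(2) mmin[of b] by (auto simp: underS_def)
  qed
  define U where "U = under r m"
  have UF: "U \<subseteq> Field r" by (auto simp: U_def under_def Field_def)
  have mU: "m \<in> U" using m W.REFL by (auto simp: U_def under_def refl_on_def)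
  have down: "underS r b \<subseteq> U" if "b \<in> U" for b
    using that W.TRANS by (auto simp: U_def under_def underS_def trans_def)
  have inj: "inj_on L U"
  proof (rule inj_onI)
    fix b c assume bc: "b \<in> U" "c \<in> U" "L b = L c"
    show "b = c"
    proof (rule ccontr)
      assume ne: "b \<noteq> c"
      have "(b, c) \<in> r \<or> (c, b) \<in> r" using bc UF W.TOTALS by blast
      then show False
        using ne bc strict[of b c] strict[of c b] by (auto simp: underS_def U_def under_def)
    qed
  qed
  define q where "q = dir_image (Restr r U) L"
  have FR: "Field (Restr r U) = U"
    using UF W.REFL by (auto simp: Field_def refl_on_def)
  have Wq: "Well_order q"
    unfolding q_def using Well_order_Restr[OF WO, of U] inj by (intro Well_order_dir_image) (simp_all add: FR)
  have Fq: "Field q = L ` U" unfolding q_def by (simp add: dir_image_Field FR)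
  have q_iff: "(L b, L c) \<in> q \<longleftrightarrow> (b, c) \<in> r" if "b \<in> U" "c \<in> U" for b c
    using that inj unfolding q_def dir_image_def inj_on_def by blast
  have q_sub: "q \<subseteq> L ` U \<times> L ` U" unfolding q_def dir_image_def by auto
  have uS: "underS q (L b) = L ` underS r b" if "b \<in> U" for b
  proof
    show "underS q (L b) \<subseteq> L ` underS r b"
    proof
      fix X assume X: "X \<in> underS q (L b)"
      then have "X \<in> L ` U" using q_sub by (auto simp: underS_def)
      then obtain c where c: "c \<in> U" "X = L c" by blast
      then show "X \<in> L ` underS r b" using X q_iff[OF c(1) that] by (auto simp: underS_def)
    qed
    show "L ` underS r b \<subseteq> underS q (L b)"
    proof
      fix X assume "X \<in> L ` underS r b"
      then obtain c where c: "c \<in> underS r b" "X = L c" by blast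
      then have cU: "c \<in> U" using down that by blast
      have "L c \<noteq> L b" using c(1) cU that inj by (auto simp: underS_def inj_on_def)
      then show "X \<in> underS q (L b)"
        using c q_iff[OF cU that] by (auto simp: underS_def)
    qed
  qed
  have pr: "is_pred q (L d) (L b) \<longleftrightarrow> is_pred r d b" if "b \<in> U" "d \<in> U" for b d
  proof -
    have "L d \<in> L ` underS r b \<longleftrightarrow> d \<in> underS r b"
      using inj down that by (auto simp: inj_on_def)
    moreover have "(L c, L d) \<in> q \<longleftrightarrow> (c, d) \<in> r" if "c \<in> underS r b" for c
      using q_iff down \<open>b \<in> U\<close> \<open>d \<in> U\<close> that by blast
    ultimately show ?thesis using uS[OF that(1)] by (auto simp: is_pred_def)
  qed
  have "b \<in> U \<longrightarrow> lower_central G T q (L b) = L b" for b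
  proof (induction b rule: ind)
    case (1 b)
    show ?case
    proof
      assume b: "b \<in> U"
      have IH: "lower_central G T q (L d) = L d" if "d \<in> underS r b" for d
        using 1 that down b by blast
      consider "underS r b = {}" | d where "is_pred r d b"
        | "underS r b \<noteq> {}" "\<nexists>d. is_pred r d b" by blast
      then show "lower_central G T q (L b) = L b"
      proof cases
        case 1
        then show ?thesis using lower_central_zero[OF Wq] uS[OF b] L0 by simp
      next
        case (2 d)
        then have d: "d \<in> underS r b" by (simp add: is_pred_def)
        then have pq: "is_pred q (L d) (L b)" using pr b down 2 by blast
        show ?thesis using lower_central_succ[OF Wq pq, of G T] IH[OF d] LS[OF 2] unfolding C_def by metis
      next
        case 3
        have "\<nexists>D. is_pred q D (L b)"
        proof
          assume "\<exists>D. is_pred q D (L b)"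
          then obtain D where D: "is_pred q D (L b)" by blast
          then have "D \<in> L ` underS r b" using uS[OF b] by (simp add: is_pred_def)
          then show False using D 3(2) pr b down by blast
        qed
        then have "lower_central G T q (L b) = (\<Inter>D\<in>L ` underS r b. lower_central G T q D)"
          using lower_central_limit[OF Wq, of "L b"] uS[OF b] 3(1) by simp
        then show ?thesis using IH LL[OF 3] by simp
      qed
    qed
  qed
  then have "lower_central G T q (L m) = {\<one>}" using mU m(2) by metis
  moreover have "L m \<in> Field q" using Fq mU by simp
  ultimately show ?thesis using Wq unfolding transfinite_nilpotent_def by blast
qed

end

end

theory Submission
  imports Defs "HOL-Algebra.Zassenhaus" "HOL-Algebra.SndIsomorphismGrp"
begin

text \<open>
  The group is metrizable as soon as it has only countably many open normal subgroups, because
  these have trivial intersection and \<open>G\<close> then embeds into a countable product of finite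
  discrete quotients (\<open>metrizable_if_countable_open_normal\<close>). Two counting arguments lead there.

  The first one uses the dense subgroups and bounds the set of \<^emph>\<open>maximal\<close> open normal subgroups
  (\<open>countable_maximal_open_normal\<close>). Call a set \<open>B\<close> of them independent if \<open>G\<close> maps onto the
  product of the quotients \<open>G/N\<close>, \<open>N \<in> F\<close>, for every finite \<open>F \<subseteq> B\<close>. This
  notion satisfies an exchange property, so a maximal independent set \<open>B\<close> behaves like a basis:
  every maximal open normal subgroup contains a finite intersection of members of \<open>B\<close>, and only
  finitely many subgroups contain a given open one. Hence if there are uncountably many maximal
  open normal subgroups, then \<open>B\<close> is uncountable. In that case the elements of \<open>G\<close> which lie in
  all but finitely many members of \<open>B\<close> form a dense subgroup that is not separable: a countable
  subset of it lies inside a single member of \<open>B\<close>, which is a proper closed subgroup.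

  The second one uses transfinite nilpotency and descends from the maximal open normal
  subgroups to all of them (\<open>countable_open_normal\<close>). Compactness forces the first term of the
  lower central series inside a proper open normal subgroup \<open>N\<close> to have successor index, and so
  \<open>G/N\<close> has a nontrivial centre. Thus there is \<open>M \<supset> N\<close> such that \<open>M/N\<close> is a central chief factor,
  and by induction it suffices to count the \<open>N\<close> belonging to a fixed \<open>M\<close>. If \<open>N\<close> contains a
  certain finite set \<open>S\<close>, the values of a factor set of the extension of \<open>G/M\<close> by \<open>M\<close>, then this
  extension splits modulo \<open>N\<close>, and \<open>N = U \<inter> M\<close> for a maximal open normal subgroup \<open>U\<close>
  (\<open>central_chief_factor_complement\<close>). There are countably many such \<open>N\<close>. The condition
  \<open>S \<subseteq> N\<close> can be dropped one element \<open>x\<close> at a time: if distinct \<open>N\<close> and \<open>N'\<close> for the same \<open>M\<close>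
  contain the same powers of \<open>x\<close>, but not \<open>x\<close>, then there is a third such subgroup \<open>L\<close> with
  \<open>x \<in> L\<close> and \<open>N' \<inter> L \<subseteq> N\<close> (\<open>central_chief_factor_exchange\<close>), so \<open>N'\<close> and \<open>L\<close> leave only
  finitely many possibilities for \<open>N\<close>.
\<close>

section \<open>Open subgroups of compact groups\<close>

context topological_group
begin

lemma continuous_map_mult:
  assumes "continuous_map X T f" "continuous_map X T g"
  shows "continuous_map X T (\<lambda>x. f x \<otimes> g x)"
proof -
  have "continuous_map X (prod_topology T T) (\<lambda>x. (f x, g x))"
    using assms by (rule continuous_map_pairedI)
  from continuous_map_compose[OF this continuous_mult] show ?thesis
    by (simp add: o_def)
qed

lemma r_coset_eq_preimage:
  assumes "N \<subseteq> carrier G" and g: "g \<in> carrier G"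
  shows "N #> g = {x \<in> topspace T. x \<otimes> inv g \<in> N}"
proof safe
  fix x assume "x \<in> topspace T" "x \<otimes> inv g \<in> N"
  then show "x \<in> N #> g"
    using g unfolding r_coset_def by (auto intro!: bexI[of _ "x \<otimes> inv g"] simp: m_assoc)
next
  fix x assume "x \<in> N #> g"
  then obtain n where "n \<in> N" "x = n \<otimes> g" unfolding r_coset_def by blast
  then show "x \<in> topspace T" "x \<otimes> inv g \<in> N" using assms by (auto simp: m_assoc subset_iff)
qed

lemma continuous_map_r_translation:
  "g \<in> carrier G \<Longrightarrow> continuous_map T T (\<lambda>x. x \<otimes> g)"
  by (intro continuous_map_mult) auto

lemma openin_r_coset:
  assumes N: "openin T N" and g: "g \<in> carrier G"
  shows "openin T (N #> g)"
  using openin_continuous_map_preimage[OF continuous_map_r_translation N, of "inv g"]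
    openin_subset[OF N] r_coset_eq_preimage[of N g] g by simp

lemma closedin_r_coset:
  assumes N: "closedin T N" and g: "g \<in> carrier G"
  shows "closedin T (N #> g)"
  using closedin_continuous_map_preimage[OF continuous_map_r_translation N, of "inv g"]
    closedin_subset[OF N] r_coset_eq_preimage[of N g] g by simp

lemma openin_subgroup_supset:
  assumes N: "openin T N" "subgroup N G" and H: "subgroup H G" "N \<subseteq> H"
  shows "openin T H"
proof -
  have "(\<Union>h\<in>H. N #> h) = H"
  proof
    show "(\<Union>h\<in>H. N #> h) \<subseteq> H"
      using H subgroup.m_closed[OF H(1)] by (auto simp: r_coset_def)
    show "H \<subseteq> (\<Union>h\<in>H. N #> h)"
      using rcos_self[OF _ N(2)] subgroup.mem_carrier[OF H(1)] by blast
  qed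
  moreover have "openin T (\<Union>h\<in>H. N #> h)"
    using openin_r_coset[OF N(1)] subgroup.mem_carrier[OF H(1)] by blast
  ultimately show ?thesis by simp
qed

lemma closedin_open_subgroup:
  assumes N: "openin T N" "subgroup N G"
  shows "closedin T N"
proof -
  have sub: "N \<subseteq> carrier G" using N(2) by (rule subgroup.subset)
  have "carrier G - N = (\<Union>g\<in>carrier G - N. N #> g)"
  proof
    show "carrier G - N \<subseteq> (\<Union>g\<in>carrier G - N. N #> g)"
      using rcos_self[OF _ N(2)] by blast
    show "(\<Union>g\<in>carrier G - N. N #> g) \<subseteq> carrier G - N"
    proof safe
      fix g x assume g: "g \<in> carrier G" "g \<notin> N" and x: "x \<in> N #> g"
      show "x \<in> carrier G" using r_coset_subset_G[OF sub g(1)] x by blast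
      assume "x \<in> N"
      with x g N(2) show False
        by (metis coset_join1 rcos_self repr_independence sub subgroup.mem_carrier coset_join2)
    qed
  qed
  moreover have "openin T (\<Union>g\<in>carrier G - N. N #> g)"
    using openin_r_coset[OF N(1)] by blast
  ultimately show ?thesis using sub by (simp add: closedin_def)
qed

end

text \<open>
  The complement is the image of a closed set under the projection along a compact factor.
\<close>

lemma openin_forall_compact:
  assumes "compact_space X" "openin (prod_topology X Y) W"
  shows "openin Y {y \<in> topspace Y. \<forall>x\<in>topspace X. (x, y) \<in> W}"
proof -
  have "closedin Y (snd ` (topspace (prod_topology X Y) - W))"
    using closed_map_snd[OF assms(1), of Y] assms(2) unfolding closed_map_def by blast
  moreover have "topspace Y - snd ` (topspace (prod_topology X Y) - W)
      = {y \<in> topspace Y. \<forall>x\<in>topspace X. (x, y) \<in> W}"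
    by (force simp: image_iff)
  ultimately show ?thesis by (metis openin_diff openin_topspace)
qed

context compact_group
begin

lemma finite_rcosets_open:
  assumes N: "openin T N" "subgroup N G"
  shows "finite (rcosets N)"
proof -
  have sub: "N \<subseteq> carrier G" using N(2) by (rule subgroup.subset)
  have U: "\<Union>(rcosets N) = topspace T"
    using rcosets_part_G[OF N(2)] by simp
  have "\<forall>C\<in>rcosets N. openin T C"
    using openin_r_coset[OF N(1)] by (auto simp: RCOSETS_def)
  then obtain F where F: "finite F" "F \<subseteq> rcosets N" "\<Union>F = topspace T"
    using compact U unfolding compact_space by meson
  have "rcosets N \<subseteq> F"
  proof
    fix C assume C: "C \<in> rcosets N"
    then obtain x where x: "x \<in> C"
      using subgroup.rcosets_non_empty[OF N(2)] by blast
    then have "x \<in> \<Union>F" using C U F(3) by blast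
    then obtain D where D: "D \<in> F" "x \<in> D" by blast
    then have "C = D"
      using rcos_disjoint[OF N(2)] x C F(2) unfolding pairwise_def disjnt_def by blast
    then show "C \<in> F" using D by simp
  qed
  then show ?thesis using F(1) finite_subset by blast
qed

text \<open>
  Such a subgroup is a union of cosets of \<open>N\<close>.
\<close>

lemma finite_subgroups_above_open:
  assumes N: "openin T N" "subgroup N G"
  shows "finite {H. subgroup H G \<and> N \<subseteq> H}"
proof -
  have "H = \<Union>{C \<in> rcosets N. C \<subseteq> H}" if H: "subgroup H G" "N \<subseteq> H" for H
  proof
    show "H \<subseteq> \<Union>{C \<in> rcosets N. C \<subseteq> H}"
    proof
      fix h assume h: "h \<in> H"
      then have hG: "h \<in> carrier G" using subgroup.mem_carrier[OF H(1)] by blast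
      have "N #> h \<subseteq> H"
        using H h subgroup.m_closed[OF H(1)] by (auto simp: r_coset_def)
      then show "h \<in> \<Union>{C \<in> rcosets N. C \<subseteq> H}"
        using rcos_self[OF hG N(2)] rcosetsI[OF subgroup.subset[OF N(2)] hG] by blast
    qed
  qed blast
  then have "{H. subgroup H G \<and> N \<subseteq> H} \<subseteq> Union ` Pow (rcosets N)"
    by (smt (verit, ccfv_SIG) Pow_iff image_iff mem_Collect_eq subsetI)
  then show ?thesis
    using finite_rcosets_open[OF N] by (meson finite_Pow_iff finite_imageI finite_subset)
qed

end

section \<open>Open normal subgroups as neighbourhoods of one\<close>

context profinite_group
begin

text \<open>
  Total disconnectedness provides a clopen \<open>V\<close> with \<open>\<one> \<in> V \<subseteq> W\<close>. The elements whose
  insertion at any place of a product never changes membership in \<open>V\<close> form the kernel of the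
  syntactic congruence of \<open>V\<close>. It is a normal subgroup since \<open>x\<close> and \<open>y\<close> vary independently,
  and it is open since they range over a compact space and the condition is clopen.
\<close>

lemma open_normal_in_nhd_one:
  assumes W: "openin T W" "\<one> \<in> W"
  obtains N where "N \<lhd> G" "openin T N" "N \<subseteq> W"
proof -
  have "separated_between T {\<one>} (topspace T - W)"
  proof (rule cut_wire_fence_theorem[OF compact Hausdorff])
    show "closedin T {\<one>}" using Hausdorff by (simp add: closedin_Hausdorff_singleton)
    show "closedin T (topspace T - W)" using W by blast
    fix C assume C: "connectedin T C"
    show "disjnt C {\<one>} \<or> disjnt C (topspace T - W)"
    proof (cases "\<one> \<in> C")
      case True
      then have "C \<subseteq> connected_component_of_set T \<one>"
        using C by (auto simp: connected_component_of_def)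
      also have "\<dots> = {\<one>}"
        using totally_disconnected by (simp add: totally_disconnected_space_def)
      finally show ?thesis using W by (auto simp: disjnt_def)
    qed (auto simp: disjnt_def)
  qed
  then obtain V where V: "openin T V" "closedin T V" "\<one> \<in> V"
    and VW: "topspace T - W \<subseteq> topspace T - V"
    unfolding separated_between by auto
  have "V \<subseteq> W" using VW openin_subset[OF V(1)] by blast
  define N where "N = {g \<in> carrier G. \<forall>x\<in>carrier G. \<forall>y\<in>carrier G.
    x \<otimes> y \<in> V \<longleftrightarrow> x \<otimes> g \<otimes> y \<in> V}"
  have NI: "g \<in> N" if "g \<in> carrier G"
    "\<And>x y. x \<in> carrier G \<Longrightarrow> y \<in> carrier G \<Longrightarrow> x \<otimes> y \<in> V \<longleftrightarrow> x \<otimes> g \<otimes> y \<in> V" for g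
    using that by (simp add: N_def)
  have NG: "g \<in> carrier G" if "g \<in> N" for g
    using that by (simp add: N_def)
  have NE: "x \<otimes> y \<in> V \<longleftrightarrow> x \<otimes> g \<otimes> y \<in> V"
    if "g \<in> N" "x \<in> carrier G" "y \<in> carrier G" for g x y
    using that unfolding N_def by blast
  have "subgroup N G"
  proof
    show "N \<subseteq> carrier G" using NG by blast
    show "\<one> \<in> N" by (rule NI) auto
    fix g assume g: "g \<in> N"
    show "g \<otimes> h \<in> N" if h: "h \<in> N" for h
    proof (rule NI)
      fix x y assume xy: "x \<in> carrier G" "y \<in> carrier G"
      have "x \<otimes> y \<in> V \<longleftrightarrow> x \<otimes> (h \<otimes> y) \<in> V"
        using NE[OF h xy] xy NG[OF h] by (simp add: m_assoc)
      also have "\<dots> \<longleftrightarrow> x \<otimes> g \<otimes> (h \<otimes> y) \<in> V"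
        using NE[OF g] xy NG[OF h] by simp
      finally show "x \<otimes> y \<in> V \<longleftrightarrow> x \<otimes> (g \<otimes> h) \<otimes> y \<in> V"
        using NG[OF g] NG[OF h] xy by (simp add: m_assoc)
    qed (use g h NG in simp)
    show "inv g \<in> N"
    proof (rule NI)
      fix x y assume xy: "x \<in> carrier G" "y \<in> carrier G"
      have "x \<otimes> inv g \<otimes> y \<in> V \<longleftrightarrow> x \<otimes> inv g \<otimes> g \<otimes> y \<in> V"
        using NE[OF g] xy NG[OF g] by simp
      also have "x \<otimes> inv g \<otimes> g = x" using xy NG[OF g] by (simp add: m_assoc)
      finally show "x \<otimes> y \<in> V \<longleftrightarrow> x \<otimes> inv g \<otimes> y \<in> V" ..
    qed (use g NG in simp)
  qed
  moreover have "h \<otimes> g \<otimes> inv h \<in> N" if h: "h \<in> carrier G" and g: "g \<in> N" for g h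
  proof (rule NI)
    fix x y assume xy: "x \<in> carrier G" "y \<in> carrier G"
    have "x \<otimes> y = (x \<otimes> h) \<otimes> (inv h \<otimes> y)"
      using h xy by (metis inv_closed m_assoc m_closed r_inv r_one)
    also have "\<dots> \<in> V \<longleftrightarrow> (x \<otimes> h) \<otimes> g \<otimes> (inv h \<otimes> y) \<in> V"
      using NE[OF g] h xy by simp
    finally show "x \<otimes> y \<in> V \<longleftrightarrow> x \<otimes> (h \<otimes> g \<otimes> inv h) \<otimes> y \<in> V"
      using NG[OF g] h xy by (simp add: m_assoc)
  qed (use g h NG in simp)
  ultimately have normal: "N \<lhd> G" by (rule normal_invI)
  have "openin T N"
  proof -
    let ?X = "prod_topology T T"
    let ?P = "prod_topology ?X T"
    have cx: "continuous_map ?P T (\<lambda>z. fst (fst z))" and cy: "continuous_map ?P T (\<lambda>z. snd (fst z))"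
      and cg: "continuous_map ?P T snd"
      using continuous_map_compose[OF continuous_map_fst continuous_map_fst]
        continuous_map_compose[OF continuous_map_fst continuous_map_snd]
      by (auto simp: o_def continuous_map_snd)
    have "continuous_map ?P T (\<lambda>z. fst (fst z) \<otimes> snd (fst z))" (is "continuous_map _ _ ?a")
      by (intro continuous_map_mult cx cy)
    moreover have "continuous_map ?P T (\<lambda>z. fst (fst z) \<otimes> snd z \<otimes> snd (fst z))"
      (is "continuous_map _ _ ?b")
      by (intro continuous_map_mult cx cy cg)
    moreover have "openin T (topspace T - V)" using V by blast
    ultimately have "openin ?P ({z \<in> topspace ?P. ?a z \<in> V} \<inter> {z \<in> topspace ?P. ?b z \<in> V} \<union>
       {z \<in> topspace ?P. ?a z \<in> topspace T - V} \<inter> {z \<in> topspace ?P. ?b z \<in> topspace T - V})"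
      (is "openin _ ?W")
      using V(1) by (intro openin_Un openin_Int openin_continuous_map_preimage)
    moreover have "compact_space ?X" using compact by (simp add: compact_space_prod_topology)
    ultimately have "openin T {g \<in> topspace T. \<forall>x\<in>topspace ?X. (x, g) \<in> ?W}"
      by (intro openin_forall_compact)
    also have "{g \<in> topspace T. \<forall>x\<in>topspace ?X. (x, g) \<in> ?W} = N"
      by (auto simp: N_def)
    finally show ?thesis .
  qed
  moreover have "N \<subseteq> V"
  proof
    fix g assume "g \<in> N"
    then show "g \<in> V" using NE[of g \<one> \<one>] NG[of g] V(3) by simp
  qed
  ultimately show ?thesis using that normal \<open>V \<subseteq> W\<close> by blast
qed

end

section \<open>Independent families of maximal open normal subgroups\<close>

lemma compact_space_Inter_subset_open:
  assumes "compact_space X" and cl: "\<And>C. C \<in> \<C> \<Longrightarrow> closedin X C"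
    and U: "openin X U" "topspace X \<inter> \<Inter>\<C> \<subseteq> U"
  obtains \<F> where "finite \<F>" "\<F> \<subseteq> \<C>" "topspace X \<inter> \<Inter>\<F> \<subseteq> U"
proof -
  have "\<exists>\<F>. finite \<F> \<and> \<F> \<subseteq> insert (topspace X - U) \<C> \<and> \<Inter>\<F> = {}"
  proof (rule ccontr)
    assume "\<not> ?thesis"
    moreover have "closedin X C" if "C \<in> insert (topspace X - U) \<C>" for C
      using that cl U(1) by blast
    ultimately have "\<Inter>(insert (topspace X - U) \<C>) \<noteq> {}"
      using assms(1) unfolding compact_space_fip by presburger
    then show False using U(2) by blast
  qed
  then obtain \<F> where \<F>: "finite \<F>" "\<F> \<subseteq> insert (topspace X - U) \<C>" "\<Inter>\<F> = {}"
    by blast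
  show ?thesis
  proof (rule that)
    show "finite (\<F> - {topspace X - U})" "\<F> - {topspace X - U} \<subseteq> \<C>"
      using \<F> by auto
    show "topspace X \<inter> \<Inter>(\<F> - {topspace X - U}) \<subseteq> U"
      using \<F>(3) by blast
  qed
qed

text \<open>
  The subgroups \<open>W\<close> compared with \<open>N\<close> are open themselves, as they contain the open \<open>N\<close>.
\<close>

definition maximal_open_normal :: "('a, 'b) monoid_scheme \<Rightarrow> 'a topology \<Rightarrow> 'a set \<Rightarrow> bool" where
  "maximal_open_normal G T N \<longleftrightarrow> N \<lhd> G \<and> openin T N \<and> N \<noteq> carrier G \<and>
     (\<forall>W. W \<lhd> G \<longrightarrow> N \<subseteq> W \<longrightarrow> W = N \<or> W = carrier G)"

text \<open>
  For normal subgroups this says that \<open>G\<close> maps onto the product of the quotients \<open>G/N\<close>,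
  \<open>N \<in> F\<close>, for every finite \<open>F \<subseteq> B\<close>. The intersection with \<open>carrier G\<close> takes care of the empty
  family, whose intersection is the universe of the type.
\<close>

definition independent_subgroups :: "('a, 'b) monoid_scheme \<Rightarrow> 'a set set \<Rightarrow> bool" where
  "independent_subgroups G B \<longleftrightarrow>
     (\<forall>F F'. finite F \<longrightarrow> finite F' \<longrightarrow> F \<subseteq> B \<longrightarrow> F' \<subseteq> B \<longrightarrow> F \<inter> F' = {} \<longrightarrow>
        (carrier G \<inter> \<Inter>F) <#>\<^bsub>G\<^esub> (carrier G \<inter> \<Inter>F') = carrier G)"

context group
begin

lemma in_set_mult_iff: "x \<in> A <#> B \<longleftrightarrow> (\<exists>a\<in>A. \<exists>b\<in>B. x = a \<otimes> b)"
  by (auto simp: set_mult_def)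

lemma subset_set_mult_left: "subgroup A G \<Longrightarrow> subgroup B G \<Longrightarrow> A \<subseteq> A <#> B"
  using subgroup.one_closed[of B G] subgroup.mem_carrier[of A G]
  by (metis in_set_mult_iff r_one subsetI)

lemma subset_set_mult_right: "subgroup A G \<Longrightarrow> subgroup B G \<Longrightarrow> B \<subseteq> A <#> B"
  using subgroup.one_closed[of A G] subgroup.mem_carrier[of B G]
  by (metis in_set_mult_iff l_one subsetI)

lemma normal_Inter:
  assumes "\<And>N. N \<in> F \<Longrightarrow> N \<lhd> G"
  shows "carrier G \<inter> \<Inter>F \<lhd> G"
proof (rule normal_invI)
  have sub: "subgroup N G" if "N \<in> F" for N using assms[OF that] by (rule normal_imp_subgroup)
  show "subgroup (carrier G \<inter> \<Inter>F) G"
    by (rule subgroupI) (auto simp: sub subgroup.one_closed subgroup.m_closed subgroup.m_inv_closed)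
  show "x \<otimes> h \<otimes> inv x \<in> carrier G \<inter> \<Inter>F"
    if "x \<in> carrier G" "h \<in> carrier G \<inter> \<Inter>F" for x h
    using that normal_invE(2)[OF assms] by auto
qed

lemma maximal_set_mult_eq_carrier:
  assumes "maximal_open_normal G T N" "K \<lhd> G" "\<not> K \<subseteq> N"
  shows "N <#> K = carrier G"
proof -
  have "N \<lhd> G" using assms(1) by (simp add: maximal_open_normal_def)
  then have "N <#> K \<lhd> G" "N \<subseteq> N <#> K" "K \<subseteq> N <#> K"
    using assms(2) normal_subgroup_set_mult_closed subset_set_mult_left subset_set_mult_right
    by (auto simp: normal_imp_subgroup)
  then show ?thesis using assms(1,3) unfolding maximal_open_normal_def by blast
qed

text \<open>
  This is the modular law. As \<open>N\<close> is maximal, \<open>G\<close> is the product of \<open>N\<close> and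
  \<open>\<Inter>(F \<union> F')\<close>. So an element of \<open>\<Inter>F\<close> is \<open>n \<otimes> z\<close> with \<open>n\<close> in \<open>N \<inter> \<Inter>F\<close> and
  \<open>z\<close> in \<open>\<Inter>(F \<union> F')\<close>, and \<open>z\<close> can be moved to the factor \<open>\<Inter>F'\<close>.
\<close>

lemma independent_Int_maximal:
  assumes ind: "independent_subgroups G B" and nB: "\<And>N. N \<in> B \<Longrightarrow> N \<lhd> G"
    and F: "finite F" "finite F'" "F \<subseteq> B" "F' \<subseteq> B" "F \<inter> F' = {}"
    and N: "maximal_open_normal G T N" and nsub: "\<not> carrier G \<inter> \<Inter>(F \<union> F') \<subseteq> N"
  shows "(carrier G \<inter> \<Inter>(insert N F)) <#> (carrier G \<inter> \<Inter>F') = carrier G"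
proof
  have nF: "carrier G \<inter> \<Inter>F \<lhd> G" and nF': "carrier G \<inter> \<Inter>F' \<lhd> G"
    and nFF': "carrier G \<inter> \<Inter>(F \<union> F') \<lhd> G"
    using F nB by (auto intro!: normal_Inter)
  note sF = normal_imp_subgroup[OF nF] and sF' = normal_imp_subgroup[OF nF']
  show "(carrier G \<inter> \<Inter>(insert N F)) <#> (carrier G \<inter> \<Inter>F') \<subseteq> carrier G"
    by (rule setmult_subset_G) auto
  show "carrier G \<subseteq> (carrier G \<inter> \<Inter>(insert N F)) <#> (carrier G \<inter> \<Inter>F')"
  proof
    fix g assume "g \<in> carrier G"
    then have "g \<in> (carrier G \<inter> \<Inter>F) <#> (carrier G \<inter> \<Inter>F')"
      using ind F unfolding independent_subgroups_def by metis
    then obtain x y where xy: "x \<in> carrier G \<inter> \<Inter>F" "y \<in> carrier G \<inter> \<Inter>F'" "g = x \<otimes> y"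
      unfolding in_set_mult_iff by blast
    then have "x \<in> N <#> (carrier G \<inter> \<Inter>(F \<union> F'))"
      using maximal_set_mult_eq_carrier[OF N nFF' nsub] by simp
    then obtain n z where nz: "n \<in> N" "z \<in> carrier G \<inter> \<Inter>(F \<union> F')" "x = n \<otimes> z"
      unfolding in_set_mult_iff by blast
    have nG: "n \<in> carrier G"
      using nz(1) N unfolding maximal_open_normal_def by (meson normal_imp_subgroup subgroup.mem_carrier)
    have "n = x \<otimes> inv z" using nz xy nG by (simp add: m_assoc)
    then have "n \<in> carrier G \<inter> \<Inter>F"
      using nz(2) xy(1) subgroup.m_closed[OF sF] subgroup.m_inv_closed[OF sF] by simp
    moreover have "z \<otimes> y \<in> carrier G \<inter> \<Inter>F'"
      using nz(2) xy(2) subgroup.m_closed[OF sF'] by simp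
    moreover have "g = n \<otimes> (z \<otimes> y)" using xy nz nG by (simp add: m_assoc)
    ultimately show "g \<in> (carrier G \<inter> \<Inter>(insert N F)) <#> (carrier G \<inter> \<Inter>F')"
      using nz(1) unfolding in_set_mult_iff by blast
  qed
qed

text \<open>
  The exchange property: with "containing a finite intersection of members of \<open>B\<close>" in the role
  of "depending on \<open>B\<close>", maximal independent families behave like bases of a vector space.
\<close>

lemma independent_insert_or_contains:
  assumes ind: "independent_subgroups G B" and nB: "\<And>N. N \<in> B \<Longrightarrow> N \<lhd> G"
    and N: "maximal_open_normal G T N"
  shows "independent_subgroups G (insert N B) \<or>
    (\<exists>E. finite E \<and> E \<subseteq> B \<and> carrier G \<inter> \<Inter>E \<subseteq> N)"
proof (rule disjCI)
  assume no: "\<nexists>E. finite E \<and> E \<subseteq> B \<and> carrier G \<inter> \<Inter>E \<subseteq> N"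
  have nN: "N \<lhd> G" using N by (simp add: maximal_open_normal_def)
  have key: "(carrier G \<inter> \<Inter>(insert N F)) <#> (carrier G \<inter> \<Inter>F') = carrier G"
    if "finite F" "finite F'" "F \<subseteq> B" "F' \<subseteq> B" "F \<inter> F' = {}" for F F'
    using independent_Int_maximal[OF ind nB that N] no that by blast
  show "independent_subgroups G (insert N B)"
    unfolding independent_subgroups_def
  proof (intro allI impI)
    fix F F' assume F: "finite F" "finite F'" "F \<subseteq> insert N B" "F' \<subseteq> insert N B" "F \<inter> F' = {}"
    consider "N \<in> F" "N \<notin> F'" | "N \<in> F'" "N \<notin> F" | "N \<notin> F" "N \<notin> F'" using F(5) by blast
    then show "(carrier G \<inter> \<Inter>F) <#> (carrier G \<inter> \<Inter>F') = carrier G"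
    proof cases
      case 1
      then have "insert N (F - {N}) = F" "F - {N} \<subseteq> B" "F' \<subseteq> B" "(F - {N}) \<inter> F' = {}"
        using F by blast+
      then show ?thesis using key[of "F - {N}" F'] F(1,2) by simp
    next
      case 2
      have "(carrier G \<inter> \<Inter>F) <#> (carrier G \<inter> \<Inter>F') = (carrier G \<inter> \<Inter>F') <#> (carrier G \<inter> \<Inter>F)"
        using F nB nN by (intro commut_normal normal_imp_subgroup normal_Inter) auto
      moreover have "insert N (F' - {N}) = F'" "F' - {N} \<subseteq> B" "F \<subseteq> B" "(F' - {N}) \<inter> F = {}"
        using F 2 by blast+
      ultimately show ?thesis using key[of "F' - {N}" F] F(1,2) by simp
    next
      case 3
      then have "F \<subseteq> B" "F' \<subseteq> B" using F by blast+
      then show ?thesis using ind F(1,2,5) unfolding independent_subgroups_def by blast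
    qed
  qed
qed

end

context topological_group
begin

lemma openin_finite_Inter:
  assumes "finite F" "\<And>N. N \<in> F \<Longrightarrow> openin T N"
  shows "openin T (carrier G \<inter> \<Inter>F)"
  using openin_Int_Inter[OF assms(1) openin_topspace assms(2)] by simp

end

context compact_group
begin

text \<open>
  A maximal independent family is as large as the set of all maximal open normal subgroups: each
  of these contains a finite intersection of members of the family, and only finitely many
  subgroups lie above such an intersection.
\<close>

lemma uncountable_independent:
  assumes unc: "uncountable {N. maximal_open_normal G T N}"
  shows "\<exists>B. uncountable B \<and> independent_subgroups G B \<and> (\<forall>N\<in>B. maximal_open_normal G T N)"
proof -
  define \<A> where "\<A> = {B. independent_subgroups G B \<and> B \<subseteq> {N. maximal_open_normal G T N}}"
  have empty: "{} \<in> \<A>"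
    using set_mult_carrier_idem[OF subgroup_self] by (simp add: \<A>_def independent_subgroups_def)
  have "\<exists>B\<in>\<A>. \<forall>X\<in>\<A>. B \<subseteq> X \<longrightarrow> X = B"
  proof (rule subset_Zorn')
    fix \<C> assume \<C>: "subset.chain \<A> \<C>"
    then have sub: "\<C> \<subseteq> \<A>" by (simp add: subset.chain_def)
    show "\<Union>\<C> \<in> \<A>"
    proof (cases "\<C> = {}")
      case False
      have "independent_subgroups G (\<Union>\<C>)"
        unfolding independent_subgroups_def
      proof (intro allI impI)
        fix F F' assume F: "finite F" "finite F'" "F \<subseteq> \<Union>\<C>" "F' \<subseteq> \<Union>\<C>" "F \<inter> F' = {}"
        then have "finite (F \<union> F')" "F \<union> F' \<subseteq> \<Union>\<C>" by auto
        then obtain B where B: "B \<in> \<C>" "F \<union> F' \<subseteq> B"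
          using False \<C> by (rule finite_subset_Union_chain)
        have "B \<in> \<A>" using B(1) sub by blast
        then have "independent_subgroups G B" by (simp add: \<A>_def)
        moreover have "F \<subseteq> B" "F' \<subseteq> B" using B(2) by auto
        ultimately show "(carrier G \<inter> \<Inter>F) <#> (carrier G \<inter> \<Inter>F') = carrier G"
          using F(1,2,5) unfolding independent_subgroups_def by simp
      qed
      moreover have "\<Union>\<C> \<subseteq> {N. maximal_open_normal G T N}" using sub unfolding \<A>_def by blast
      ultimately show ?thesis by (simp add: \<A>_def)
    qed (use empty in simp)
  qed
  then obtain B where B: "B \<in> \<A>" and Bmax: "\<And>X. X \<in> \<A> \<Longrightarrow> B \<subseteq> X \<Longrightarrow> X = B" by blast
  have mB: "maximal_open_normal G T N" if "N \<in> B" for N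
    using B that by (auto simp: \<A>_def)
  have ind: "independent_subgroups G B" using B by (simp add: \<A>_def)
  have nB: "N \<lhd> G" "openin T N" if "N \<in> B" for N
    using mB[OF that] by (auto simp: maximal_open_normal_def)
  \<comment> \<open>By maximality of \<open>B\<close> the exchange property always yields its second alternative; for
  \<open>N \<in> B\<close> take \<open>E = {N}\<close>.\<close>
  have cover: "\<exists>E. finite E \<and> E \<subseteq> B \<and> carrier G \<inter> \<Inter>E \<subseteq> N" if N: "maximal_open_normal G T N" for N
  proof (rule ccontr)
    assume no: "\<not> ?thesis"
    then have "independent_subgroups G (insert N B)"
      using independent_insert_or_contains[OF ind nB(1) N] by blast
    then have "insert N B \<in> \<A>" using N B by (simp add: \<A>_def)
    then have "N \<in> B" using Bmax by blast
    then have "finite {N}" "{N} \<subseteq> B" "carrier G \<inter> \<Inter>{N} \<subseteq> N" by auto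
    then show False using no by blast
  qed
  have "uncountable B"
  proof
    assume "countable B"
    then have cE: "countable {E. finite E \<and> E \<subseteq> B}" by (rule countable_Collect_finite_subset)
    have "countable {H. subgroup H G \<and> carrier G \<inter> \<Inter>E \<subseteq> H}"
      if "E \<in> {E. finite E \<and> E \<subseteq> B}" for E
    proof (intro countable_finite finite_subgroups_above_open)
      show "openin T (carrier G \<inter> \<Inter>E)"
        using that nB by (intro openin_finite_Inter) auto
      show "subgroup (carrier G \<inter> \<Inter>E) G"
        using that nB by (intro normal_imp_subgroup normal_Inter) auto
    qed
    from countable_UN[OF cE this]
    have "countable (\<Union>E\<in>{E. finite E \<and> E \<subseteq> B}. {H. subgroup H G \<and> carrier G \<inter> \<Inter>E \<subseteq> H})" .
    moreover have "{N. maximal_open_normal G T N} \<subseteq>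
      (\<Union>E\<in>{E. finite E \<and> E \<subseteq> B}. {H. subgroup H G \<and> carrier G \<inter> \<Inter>E \<subseteq> H})"
    proof
      fix N assume "N \<in> {N. maximal_open_normal G T N}"
      then have N: "maximal_open_normal G T N" by simp
      then have "subgroup N G" by (simp add: maximal_open_normal_def normal_imp_subgroup)
      with cover[OF N] show "N \<in> (\<Union>E\<in>{E. finite E \<and> E \<subseteq> B}.
          {H. subgroup H G \<and> carrier G \<inter> \<Inter>E \<subseteq> H})" by blast
    qed
    ultimately show False using unc countable_subset by blast
  qed
  then show ?thesis using ind mB by blast
qed

text \<open>
  A Chinese remainder theorem for infinitely many conditions. Independence solves any finite
  number of them at once. Each condition defines a closed set, so compactness does the rest.
\<close>

lemma independent_interpolation:
  assumes ind: "independent_subgroups G B" and nB: "\<And>N. N \<in> B \<Longrightarrow> N \<lhd> G" "\<And>N. N \<in> B \<Longrightarrow> openin T N"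
    and F: "finite F" "F \<subseteq> B" and g: "g \<in> carrier G"
  obtains h where "h \<in> (carrier G \<inter> \<Inter>F) #> g" "\<And>N. N \<in> B - F \<Longrightarrow> h \<in> N"
proof -
  let ?K = "carrier G \<inter> \<Inter>F"
  have sK: "subgroup ?K G" using F nB by (intro normal_imp_subgroup normal_Inter) auto
  have "openin T ?K"
    using F nB by (intro openin_finite_Inter) auto
  then have "closedin T (?K #> g)" using sK g by (intro closedin_r_coset closedin_open_subgroup)
  moreover have "closedin T N" if "N \<in> B" for N
    using nB that by (simp add: closedin_open_subgroup normal_imp_subgroup)
  ultimately have cl: "closedin T C" if "C \<in> insert (?K #> g) (B - F)" for C
    using that by blast
  have "\<Inter>\<V> \<noteq> {}" if \<V>: "finite \<V>" "\<V> \<subseteq> insert (?K #> g) (B - F)" for \<V>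
  proof -
    define F' where "F' = \<V> - {?K #> g}"
    have "finite F'" "F' \<subseteq> B" "F \<inter> F' = {}" using \<V> by (auto simp: F'_def)
    then have "g \<in> ?K <#> (carrier G \<inter> \<Inter>F')"
      using ind F g unfolding independent_subgroups_def by metis
    then obtain k h where kh: "k \<in> ?K" "h \<in> carrier G \<inter> \<Inter>F'" "g = k \<otimes> h"
      unfolding in_set_mult_iff by blast
    then have "h = inv k \<otimes> g" by (metis IntD1 inv_closed l_inv l_one m_assoc)
    then have "h \<in> ?K #> g"
      using kh(1) subgroup.m_inv_closed[OF sK] unfolding r_coset_def by blast
    then have "h \<in> \<Inter>\<V>" using kh(2) by (auto simp: F'_def)
    then show ?thesis by blast
  qed
  then have "\<Inter>(insert (?K #> g) (B - F)) \<noteq> {}"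
    using compact cl unfolding compact_space_fip by presburger
  then show ?thesis using that by blast
qed

end

context profinite_group
begin

text \<open>
  \<open>H\<close> is the preimage of the direct sum under the map from \<open>G\<close> to the product of the \<open>G/N\<close>,
  \<open>N \<in> B\<close>. To reach a given coset of an open normal subgroup \<open>N\<close> from \<open>H\<close>, observe that by
  compactness the open subgroup generated by \<open>N\<close> and the kernel \<open>K\<close> of this map contains
  \<open>\<Inter>F\<close> for a finite \<open>F \<subseteq> B\<close>. Interpolation gives an element of \<open>H\<close> in the prescribed
  coset of \<open>\<Inter>F\<close>, and it may be corrected by an element of \<open>K\<close>, as \<open>K \<subseteq> H\<close>.
\<close>

lemma dense_finite_support_subgroup:
  assumes ind: "independent_subgroups G B" and nB: "\<And>N. N \<in> B \<Longrightarrow> N \<lhd> G" "\<And>N. N \<in> B \<Longrightarrow> openin T N"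
  defines "H \<equiv> {g \<in> carrier G. finite {N \<in> B. g \<notin> N}}"
  shows "subgroup H G" "T closure_of H = topspace T"
proof -
  have sB: "subgroup N G" if "N \<in> B" for N using nB that by (simp add: normal_imp_subgroup)
  show sH: "subgroup H G"
  proof
    show "H \<subseteq> carrier G" by (auto simp: H_def)
    have "{N \<in> B. \<one> \<notin> N} = {}" using sB by (auto simp: subgroup.one_closed)
    then have "finite {N \<in> B. \<one> \<notin> N}" by (simp only: finite.emptyI)
    then show "\<one> \<in> H" by (simp add: H_def)
    fix x assume x: "x \<in> H"
    show "x \<otimes> y \<in> H" if y: "y \<in> H" for y
    proof -
      have "{N \<in> B. x \<otimes> y \<notin> N} \<subseteq> {N \<in> B. x \<notin> N} \<union> {N \<in> B. y \<notin> N}"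
        using subgroup.m_closed[OF sB] by blast
      moreover have "finite ({N \<in> B. x \<notin> N} \<union> {N \<in> B. y \<notin> N})"
        using x y by (simp add: H_def)
      ultimately have "finite {N \<in> B. x \<otimes> y \<notin> N}" by (rule finite_subset)
      then show ?thesis using x y by (simp add: H_def)
    qed
    have "{N \<in> B. inv x \<notin> N} \<subseteq> {N \<in> B. x \<notin> N}"
      by (auto dest: subgroup.m_inv_closed[OF sB])
    moreover have "finite {N \<in> B. x \<notin> N}" using x by (simp add: H_def)
    ultimately have "finite {N \<in> B. inv x \<notin> N}" by (rule finite_subset)
    then show "inv x \<in> H" using x by (simp add: H_def)
  qed
  define K where "K = carrier G \<inter> \<Inter>B"
  have nK: "K \<lhd> G" unfolding K_def using nB by (intro normal_Inter)
  have KH: "K \<subseteq> H"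
  proof
    fix k assume "k \<in> K"
    then have "{N \<in> B. k \<notin> N} = {}" and k: "k \<in> carrier G" by (auto simp: K_def)
    then have "finite {N \<in> B. k \<notin> N}" by (simp only: finite.emptyI)
    then show "k \<in> H" using k by (simp add: H_def)
  qed
  have meets: "\<exists>h\<in>H. h \<in> W" if g: "g \<in> carrier G" and W: "g \<in> W" "openin T W" for g W
  proof -
    have "openin T {x \<in> topspace T. x \<otimes> g \<in> W}"
      using continuous_map_r_translation[OF g] W(2) by (rule openin_continuous_map_preimage)
    then obtain N where N: "N \<lhd> G" "openin T N" "N \<subseteq> {x \<in> topspace T. x \<otimes> g \<in> W}"
      by (rule open_normal_in_nhd_one) (use g W(1) in simp)
    note sN = normal_imp_subgroup[OF N(1)] and sK = normal_imp_subgroup[OF nK]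
    have "subgroup (N <#> K) G" using N(1) sK by (rule mult_norm_subgroup)
    then have NK: "openin T (N <#> K)"
      by (rule openin_subgroup_supset[OF N(2) sN _ subset_set_mult_left[OF sN sK]])
    have KNK: "topspace T \<inter> \<Inter>B \<subseteq> N <#> K"
      using subset_set_mult_right[OF sN sK] by (simp add: K_def)
    have "closedin T C" if "C \<in> B" for C
      using nB(2) that sB by (simp add: closedin_open_subgroup)
    then obtain F where F: "finite F" "F \<subseteq> B" "topspace T \<inter> \<Inter>F \<subseteq> N <#> K"
      by (rule compact_space_Inter_subset_open[OF compact _ NK KNK])
    obtain h where h: "h \<in> (carrier G \<inter> \<Inter>F) #> g" "\<And>N. N \<in> B - F \<Longrightarrow> h \<in> N"
      using independent_interpolation[OF ind nB F(1,2) g] by blast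
    then obtain c where c: "c \<in> carrier G \<inter> \<Inter>F" "h = c \<otimes> g" unfolding r_coset_def by blast
    have "{N \<in> B. h \<notin> N} \<subseteq> F" using h(2) by blast
    then have "finite {N \<in> B. h \<notin> N}" using F(1) by (rule finite_subset)
    then have "h \<in> H" using c g by (simp add: H_def)
    have "c \<in> N <#> K" using c(1) F(3) by auto
    then obtain n k where nk: "n \<in> N" "k \<in> K" "c = n \<otimes> k" unfolding in_set_mult_iff by blast
    have nkG: "n \<in> carrier G" "k \<in> carrier G"
      using nk subgroup.mem_carrier[OF sN] subgroup.mem_carrier[OF sK] by auto
    \<comment> \<open>The factor in \<open>K\<close> is moved to the right of \<open>g\<close> so that it can be cancelled inside \<open>H\<close>.\<close>
    define k' where "k' = inv g \<otimes> k \<otimes> g"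
    have k': "k' \<in> K" using normal_invE(2)[OF nK, of "inv g" k] nk(2) g by (simp add: k'_def)
    have k'G: "k' \<in> carrier G" using subgroup.mem_carrier[OF sK k'] .
    have "k \<otimes> g = g \<otimes> k'" using g nkG by (simp add: k'_def flip: m_assoc)
    then have "h = n \<otimes> g \<otimes> k'" using c(2) nk(3) nkG g k'G by (simp add: m_assoc)
    then have eq: "h \<otimes> inv k' = n \<otimes> g" using nkG g k'G by (simp add: m_assoc)
    have "h \<otimes> inv k' \<in> H"
      using \<open>h \<in> H\<close> k' KH subgroup.m_closed[OF sH] subgroup.m_inv_closed[OF sH] by blast
    moreover have "n \<otimes> g \<in> W" using N(3) nk(1) by blast
    ultimately show ?thesis using eq by metis
  qed
  show "T closure_of H = topspace T"
  proof
    show "topspace T \<subseteq> T closure_of H"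
    proof
      fix x assume "x \<in> topspace T"
      then show "x \<in> T closure_of H"
        using meets[of x] unfolding in_closure_of by auto
    qed
  qed (rule closure_of_subset_topspace)
qed

text \<open>
  An element of the dense subgroup avoids only finitely many members of an uncountable \<open>B\<close>. So
  a countable subset lies in some member of \<open>B\<close>, which is closed and proper.
\<close>

lemma countable_maximal_open_normal:
  assumes sep: "\<And>H. subgroup H G \<Longrightarrow> T closure_of H = topspace T
            \<Longrightarrow> separable_space (subtopology T H)"
  shows "countable {N. maximal_open_normal G T N}"
proof (rule ccontr)
  assume "uncountable {N. maximal_open_normal G T N}"
  from uncountable_independent[OF this]
  obtain B where B: "uncountable B" "independent_subgroups G B"
    and mB': "\<forall>N\<in>B. maximal_open_normal G T N"
    by (elim exE conjE)
  have mB: "maximal_open_normal G T N" if "N \<in> B" for N using mB' that by simp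
  have nB: "N \<lhd> G" "openin T N" if "N \<in> B" for N
    using mB[OF that] by (auto simp: maximal_open_normal_def)
  define H where "H = {g \<in> carrier G. finite {N \<in> B. g \<notin> N}}"
  have H: "subgroup H G" "T closure_of H = topspace T"
    using dense_finite_support_subgroup[OF B(2) nB] by (simp_all add: H_def)
  obtain C where C: "countable C" "C \<subseteq> topspace (subtopology T H)"
    "subtopology T H closure_of C = topspace (subtopology T H)"
    using sep[OF H] unfolding separable_space_def by blast
  have CH: "C \<subseteq> H" using C(2) by simp
  have "countable {N \<in> B. c \<notin> N}" if "c \<in> C" for c
  proof (rule countable_finite)
    have "c \<in> H" using that CH by blast
    then show "finite {N \<in> B. c \<notin> N}" by (simp add: H_def)
  qed
  then have cnt: "countable (\<Union>c\<in>C. {N \<in> B. c \<notin> N})" by (rule countable_UN[OF C(1)])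
  have "\<not> B \<subseteq> (\<Union>c\<in>C. {N \<in> B. c \<notin> N})"
    using countable_subset[OF _ cnt] B(1) by blast
  then obtain N where N: "N \<in> B" and CN: "C \<subseteq> N" by blast
  have clN: "closedin T N" using nB N by (simp add: closedin_open_subgroup normal_imp_subgroup)
  have "H \<subseteq> T closure_of C"
  proof -
    have "topspace (subtopology T H) = H" using subgroup.subset[OF H(1)] by auto
    then show ?thesis using C(3) by (metis closure_of_subtopology_subset)
  qed
  also have "\<dots> \<subseteq> N" using CN clN by (rule closure_of_minimal)
  finally have "T closure_of H \<subseteq> N" using clN by (rule closure_of_minimal)
  then have "N = carrier G"
    using H(2) closedin_subset[OF clN] by simp
  then show False using mB[OF N] by (simp add: maximal_open_normal_def)
qed

end

section \<open>Central chief factors from the lower central series\<close>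

text \<open>
  For a normal subgroup \<open>N\<close> this says that the image of \<open>M\<close> in \<open>G/N\<close> is central.
\<close>

definition central_modulo :: "('a, 'b) monoid_scheme \<Rightarrow> 'a set \<Rightarrow> 'a set \<Rightarrow> bool" where
  "central_modulo G M N \<longleftrightarrow>
     (\<forall>g\<in>carrier G. \<forall>m\<in>M. g \<otimes>\<^bsub>G\<^esub> m \<otimes>\<^bsub>G\<^esub> inv\<^bsub>G\<^esub> g \<otimes>\<^bsub>G\<^esub> inv\<^bsub>G\<^esub> m \<in> N)"

context topological_group
begin

text \<open>
  The three properties are proved together: monotonicity at a successor is the second property
  of its predecessor, which in turn follows from monotonicity. Closedness makes the terms
  accessible to compactness arguments at limit ordinals.
\<close>

lemma lower_central_decreasing:
  assumes WO: "Well_order r"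
  shows "(\<forall>b\<in>underS r c. lower_central G T r c \<subseteq> lower_central G T r b) \<and>
    closed_commutator G T (lower_central G T r c) \<subseteq> lower_central G T r c \<and>
    closedin T (lower_central G T r c)"
    (is "?P c")
proof -
  interpret W: wo_rel r using WO by (simp add: wo_rel_def)
  let ?L = "lower_central G T r" and ?C = "closed_commutator G T"
  show ?thesis
  proof (induction c rule: W.well_order_induct)
    case (1 c)
    have IH: "?P b" if "b \<in> underS r c" for b
      using 1 that by (simp add: underS_def)
    consider "underS r c = {}" | d where "is_pred r d c"
      | "underS r c \<noteq> {}" "\<nexists>d. is_pred r d c" by blast
    then show ?case
    proof cases
      case 1
      then show ?thesis
        using lower_central_zero[OF WO 1, of G T] closed_commutator_subset closedin_topspace[of T] by simp
    next
      case (2 d)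
      have Lc: "?L c = ?C (?L d)" using WO 2 by (rule lower_central_succ)
      have d: "d \<in> underS r c" and le: "\<And>b. b \<in> underS r c \<Longrightarrow> (b, d) \<in> r"
        using 2 by (simp_all add: is_pred_def)
      have "?L c \<subseteq> ?L d" using IH[OF d] Lc by simp
      moreover have "?L d \<subseteq> ?L b" if "b \<in> underS r c" for b
        using IH[OF d] le[OF that] by (cases "b = d") (auto simp: underS_def)
      moreover have "closedin T (?L c)" unfolding Lc closed_commutator_def by simp
      ultimately show ?thesis using closed_commutator_mono[of "?L c" "?L d"] Lc by auto
    next
      case 3
      then have Lc: "?L c = (\<Inter>b\<in>underS r c. ?L b)" using WO by (intro lower_central_limit)
      have "?C (?L c) \<subseteq> ?L b" if b: "b \<in> underS r c" for b
      proof -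
        have "?C (?L c) \<subseteq> ?C (?L b)" using b by (intro closed_commutator_mono) (auto simp: Lc)
        then show ?thesis using IH[OF b] by blast
      qed
      moreover have "closedin T (?L c)" unfolding Lc using IH 3(1) by (intro closedin_INT) auto
      ultimately show ?thesis using Lc by auto
    qed
  qed
qed

text \<open>
  The set is the preimage of the centre of \<open>G/N\<close>.
\<close>

lemma subgroup_preimage_center:
  assumes N: "N \<lhd> G"
  shows "subgroup {m \<in> carrier G. central_modulo G {m} N} G" (is "subgroup ?M G")
proof
  note sN = normal_imp_subgroup[OF N]
  have NG: "n \<in> carrier G" if "n \<in> N" for n using subgroup.mem_carrier[OF sN that] .
  show "?M \<subseteq> carrier G" by blast
  show "\<one> \<in> ?M" using subgroup.one_closed[OF sN] by (simp add: central_modulo_def)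
  fix a assume a: "a \<in> ?M"
  show "a \<otimes> b \<in> ?M" if b: "b \<in> ?M" for b
  proof -
    have "g \<otimes> (a \<otimes> b) \<otimes> inv g \<otimes> inv (a \<otimes> b) \<in> N" if g: "g \<in> carrier G" for g
    proof -
      have "g \<otimes> a \<otimes> inv g \<otimes> inv a \<in> N" "a \<otimes> (g \<otimes> b \<otimes> inv g \<otimes> inv b) \<otimes> inv a \<in> N"
        using a b g normal_invE(2)[OF N] by (auto simp: central_modulo_def)
      then have "(g \<otimes> a \<otimes> inv g \<otimes> inv a) \<otimes> (a \<otimes> (g \<otimes> b \<otimes> inv g \<otimes> inv b) \<otimes> inv a) \<in> N"
        by (rule subgroup.m_closed[OF sN])
      also have "(g \<otimes> a \<otimes> inv g \<otimes> inv a) \<otimes> (a \<otimes> (g \<otimes> b \<otimes> inv g \<otimes> inv b) \<otimes> inv a)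
          = g \<otimes> (a \<otimes> b) \<otimes> inv g \<otimes> inv (a \<otimes> b)"
        using a b g by (simp add: m_assoc inv_mult_group) (simp add: inv_mult_group flip: m_assoc)
      finally show ?thesis .
    qed
    then show ?thesis using a b by (simp add: central_modulo_def)
  qed
  have "g \<otimes> inv a \<otimes> inv g \<otimes> inv (inv a) \<in> N" if g: "g \<in> carrier G" for g
  proof -
    have "inv (g \<otimes> a \<otimes> inv g \<otimes> inv a) \<in> N"
      using a g subgroup.m_inv_closed[OF sN] by (auto simp: central_modulo_def)
    then have "inv a \<otimes> inv (g \<otimes> a \<otimes> inv g \<otimes> inv a) \<otimes> inv (inv a) \<in> N"
      using a normal_invE(2)[OF N, of "inv a"] by simp
    also have "inv a \<otimes> inv (g \<otimes> a \<otimes> inv g \<otimes> inv a) \<otimes> inv (inv a) = g \<otimes> inv a \<otimes> inv g \<otimes> inv (inv a)"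
      using a g by (simp add: inv_mult_group m_assoc) (simp flip: m_assoc)
    finally show ?thesis .
  qed
  then show "inv a \<in> ?M" using a by (simp add: central_modulo_def)
qed

end

text \<open>
  Chief factors are usually defined by normal subgroups \<open>Q\<close>. Here all subgroups \<open>Q\<close> may be
  admitted, since those between \<open>N\<close> and \<open>M\<close> are normal by centrality
  (\<open>normal_central_chief_factor\<close>).
\<close>

definition central_chief_factor :: "('a, 'b) monoid_scheme \<Rightarrow> 'a set \<Rightarrow> 'a set \<Rightarrow> bool" where
  "central_chief_factor G M N \<longleftrightarrow> subgroup M G \<and> subgroup N G \<and> N \<subset> M \<and> central_modulo G M N \<and>
     (\<forall>Q. subgroup Q G \<longrightarrow> N \<subseteq> Q \<longrightarrow> Q \<subseteq> M \<longrightarrow> Q = N \<or> Q = M)"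

lemma (in group) normal_central_chief_factor:
  assumes "central_chief_factor G M N" and Q: "subgroup Q G" "N \<subseteq> Q" "Q \<subseteq> M"
  shows "Q \<lhd> G"
proof (rule normal_invI[OF Q(1)])
  fix g q assume g: "g \<in> carrier G" and q: "q \<in> Q"
  have qG: "q \<in> carrier G" using subgroup.mem_carrier[OF Q(1) q] .
  have "g \<otimes> q \<otimes> inv g \<otimes> inv q \<in> Q"
    using assms(1) g q Q unfolding central_chief_factor_def central_modulo_def by blast
  then have "(g \<otimes> q \<otimes> inv g \<otimes> inv q) \<otimes> q \<in> Q" using q by (rule subgroup.m_closed[OF Q(1)])
  then show "g \<otimes> q \<otimes> inv g \<in> Q" using g qG by (simp add: m_assoc)
qed

context compact_group
begin

text \<open>
  Consider the first term of the lower central series inside \<open>N\<close>. Its index is not zero. It is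
  not a limit either: a chain of closed sets with intersection inside the open set \<open>N\<close> has a
  member inside \<open>N\<close>. So it is a successor, and the preceding term contains elements outside \<open>N\<close>
  whose commutators with all of \<open>G\<close> lie in \<open>N\<close>.
\<close>

lemma transfinite_nilpotent_not_centreless:
  assumes nil: "transfinite_nilpotent G T" and N: "subgroup N G" "openin T N" "N \<noteq> carrier G"
  obtains m where "m \<in> carrier G" "m \<notin> N" "central_modulo G {m} N"
proof -
  obtain r :: "'a set rel" and a where WO: "Well_order r" and a: "a \<in> Field r"
    "lower_central G T r a = {\<one>}"
    using nil unfolding transfinite_nilpotent_def by blast
  interpret W: wo_rel r using WO by (simp add: wo_rel_def)
  define L where "L = lower_central G T r"
  have anti: "L c \<subseteq> L b" if "b \<in> underS r c" for b c
    using lower_central_decreasing[OF WO] that unfolding L_def by blast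
  have cl: "closedin T (L c)" for c
    using lower_central_decreasing[OF WO] unfolding L_def by blast
  define Z where "Z = {b \<in> Field r. L b \<subseteq> N}"
  have Z: "Z \<subseteq> Field r" "Z \<noteq> {}"
    using a subgroup.one_closed[OF N(1)] by (auto simp: Z_def L_def)
  define m where "m = W.minim Z"
  have m: "L m \<subseteq> N" using W.minim_in[OF Z] by (simp add: m_def Z_def)
  have below: "\<not> L b \<subseteq> N" if "b \<in> underS r m" for b
  proof
    assume "L b \<subseteq> N"
    moreover have "b \<in> Field r" using that by (auto simp: underS_def Field_def)
    ultimately have "(m, b) \<in> r" using W.minim_least[OF Z(1)] by (simp add: Z_def m_def)
    then show False using that W.ANTISYM by (auto simp: underS_def antisym_def)
  qed
  have NG: "\<not> carrier G \<subseteq> N" using N(1,3) subgroup.subset by blast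
  consider "underS r m = {}" | d where "is_pred r d m"
    | "underS r m \<noteq> {}" "\<nexists>d. is_pred r d m" by blast
  then show ?thesis
  proof cases
    case 1
    then show ?thesis using lower_central_zero[OF WO 1, of G T] m NG by (simp add: L_def)
  next
    case (2 d)
    then have "\<not> L d \<subseteq> N" using below by (simp add: is_pred_def)
    then obtain x where x: "x \<in> L d" "x \<notin> N" by blast
    have xG: "x \<in> carrier G" using x(1) closedin_subset[OF cl[of d]] by auto
    have "closed_commutator G T (L d) \<subseteq> N"
      using lower_central_succ[OF WO 2, of G T] m by (simp add: L_def)
    moreover have "{g \<otimes> h \<otimes> inv g \<otimes> inv h | g h. g \<in> carrier G \<and> h \<in> L d} \<subseteq> closed_commutator G T (L d)"
      (is "?S \<subseteq> _")
    proof -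
      have "?S \<subseteq> carrier G" using closedin_subset[OF cl[of d]] by auto
      then have "generate G ?S \<subseteq> topspace T" using generate_incl by simp
      moreover have "?S \<subseteq> generate G ?S" by (auto intro: generate.incl)
      ultimately show ?thesis
        unfolding closed_commutator_def using closure_of_subset[of "generate G ?S" T] by (rule_tac order_trans)
    qed
    ultimately have "central_modulo G {x} N" using x(1) unfolding central_modulo_def by blast
    then show ?thesis using that x(2) xG by blast
  next
    case 3
    have Lm: "L m = (\<Inter>b\<in>underS r m. L b)"
      unfolding L_def using WO 3 by (rule lower_central_limit)
    have "topspace T \<inter> \<Inter>(L ` underS r m) \<subseteq> N" using m Lm by auto
    then obtain F where F: "finite F" "F \<subseteq> L ` underS r m" "topspace T \<inter> \<Inter>F \<subseteq> N"
      using cl by (rule_tac compact_space_Inter_subset_open[OF compact _ N(2)]) auto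
    obtain I where I: "finite I" "I \<subseteq> underS r m" "F = L ` I"
      using finite_subset_image[OF F(1,2)] by blast
    \<comment> \<open>A lower bound in the chain is needed rather than a finite intersection; it also exists for
    empty \<open>I\<close> because the index is not zero.\<close>
    have "\<exists>b\<in>underS r m. \<forall>i\<in>I. L b \<subseteq> L i"
      using I(1,2)
    proof (induction I rule: finite_induct)
      case empty
      then show ?case using 3(1) by blast
    next
      case (insert i I)
      then obtain b where b: "b \<in> underS r m" "\<forall>j\<in>I. L b \<subseteq> L j" by blast
      have i: "i \<in> underS r m" using insert.prems by simp
      have "i \<in> Field r" "b \<in> Field r" using i b(1) by (auto simp: underS_def Field_def)
      then consider "i = b" | "i \<in> underS r b" | "b \<in> underS r i"
        using W.TOTALS by (auto simp: underS_def)
      then show ?case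
      proof cases
        case 1
        then show ?thesis using b by blast
      next
        case 2
        then show ?thesis using b anti[of i b] by blast
      next
        case 3
        then show ?thesis using b i anti[of b i] by blast
      qed
    qed
    then obtain b where b: "b \<in> underS r m" "\<forall>i\<in>I. L b \<subseteq> L i" by blast
    have "L b \<subseteq> topspace T \<inter> \<Inter>F" using b(2) I(3) closedin_subset[OF cl[of b]] by auto
    then show ?thesis using F(3) below[OF b(1)] by blast
  qed
qed

text \<open>
  Take \<open>M\<close> minimal among the finitely many subgroups strictly above \<open>N\<close> and inside the preimage
  of the centre of \<open>G/N\<close>.
\<close>

lemma transfinite_nilpotent_central_chief_factor:
  assumes nil: "transfinite_nilpotent G T" and N: "N \<lhd> G" "openin T N" "N \<noteq> carrier G"
  obtains M where "central_chief_factor G M N"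
proof -
  note sN = normal_imp_subgroup[OF N(1)]
  let ?S = "{M. subgroup M G \<and> N \<subset> M \<and> central_modulo G M N}"
  let ?M = "{m \<in> carrier G. central_modulo G {m} N}"
  have fin: "finite ?S" by (rule finite_subset[OF _ finite_subgroups_above_open[OF N(2) sN]]) auto
  have ne: "?M \<in> ?S"
  proof -
    obtain m where "m \<in> carrier G" "m \<notin> N" "central_modulo G {m} N"
      using transfinite_nilpotent_not_centreless[OF nil sN N(2,3)] by blast
    moreover have "N \<subseteq> ?M"
      using normal_invE(2)[OF N(1)] subgroup.m_closed[OF sN] subgroup.m_inv_closed[OF sN]
        subgroup.mem_carrier[OF sN]
      by (auto simp: central_modulo_def)
    moreover have "central_modulo G ?M N" by (auto simp: central_modulo_def)
    ultimately show ?thesis using subgroup_preimage_center[OF N(1)] by blast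
  qed
  obtain M where M: "M \<in> ?S" "\<forall>Q\<in>?S. Q \<subseteq> M \<longrightarrow> M = Q"
    using finite_has_minimal[OF fin] ne by (metis (no_types, lifting) empty_iff)
  have "Q = N \<or> Q = M" if "subgroup Q G" "N \<subseteq> Q" "Q \<subseteq> M" for Q
  proof (cases "Q = N")
    case False
    then have "Q \<in> ?S" using that M(1) by (auto simp: central_modulo_def)
    then show ?thesis using M(2) that(3) by blast
  qed blast
  then show ?thesis using that M(1) sN unfolding central_chief_factor_def by blast
qed

end

section \<open>Counting the central chief factors below a fixed subgroup\<close>

text \<open>
  Every subgroup of the integers consists of the multiples of one integer.
\<close>

lemma countable_int_subgroups:
  "countable {J :: int set. 0 \<in> J \<and> (\<forall>a\<in>J. \<forall>b\<in>J. a - b \<in> J)}"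
proof -
  have "J \<in> range (\<lambda>d. range (\<lambda>k. k * d))"
    if J: "0 \<in> J" "\<forall>a\<in>J. \<forall>b\<in>J. a - b \<in> J" for J :: "int set"
  proof (cases "J = {0}")
    case True
    then have "J = range (\<lambda>k. k * 0)" by auto
    then show ?thesis by blast
  next
    case False
    then obtain a where a: "a \<in> J" "a \<noteq> 0" using J(1) by blast
    have neg: "- b \<in> J" if "b \<in> J" for b using J that by (metis diff_0)
    have "\<bar>a\<bar> \<in> J" using a neg by (simp add: abs_if)
    then have ex: "\<exists>n::nat. 0 < n \<and> int n \<in> J"
      using a(2) by (intro exI[of _ "nat \<bar>a\<bar>"]) simp
    define d where "d = (LEAST n::nat. 0 < n \<and> int n \<in> J)"
    have d: "0 < d" "int d \<in> J" using LeastI_ex[OF ex] by (simp_all add: d_def)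
    have least: "d \<le> n" if "0 < n" "int n \<in> J" for n
      using that Least_le[of "\<lambda>n. 0 < n \<and> int n \<in> J" n] by (simp add: d_def)
    have add: "b + c \<in> J" if "b \<in> J" "c \<in> J" for b c
    proof -
      have "b - (- c) \<in> J" using J(2)[rule_format, OF that(1) neg[OF that(2)]] .
      then show ?thesis by simp
    qed
    have natmul: "int n * int d \<in> J" for n
      by (induction n) (use J(1) d(2) add in \<open>auto simp: algebra_simps\<close>)
    have mul: "k * int d \<in> J" for k
    proof (cases k rule: int_cases2)
      case (nonneg n)
      then show ?thesis using natmul[of n] by simp
    next
      case (nonpos n)
      then show ?thesis using neg[OF natmul[of n]] by simp
    qed
    have "J = range (\<lambda>k. k * int d)"
    proof
      show "J \<subseteq> range (\<lambda>k. k * int d)"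
      proof
        fix b assume b: "b \<in> J"
        have "b mod int d \<in> J"
          using J(2) b mul by (simp add: minus_div_mult_eq_mod [symmetric])
        moreover have "0 \<le> b mod int d" "b mod int d < int d" using d(1) by auto
        ultimately have "b mod int d = 0"
          using least[of "nat (b mod int d)"] by (cases "b mod int d = 0") auto
        then have "b = (b div int d) * int d" by (metis add.right_neutral div_mult_mod_eq)
        then show "b \<in> range (\<lambda>k. k * int d)" by blast
      qed
    qed (use mul in blast)
    then show ?thesis by blast
  qed
  then have "{J :: int set. 0 \<in> J \<and> (\<forall>a\<in>J. \<forall>b\<in>J. a - b \<in> J)} \<subseteq> range (\<lambda>d. range (\<lambda>k. k * d))"
    by blast
  then show ?thesis by (rule countable_subset) simp
qed

context group
begin

text \<open>
  If \<open>N \<noteq> N'\<close>, then \<open>M/(N \<inter> N')\<close> is the direct product of the simple central groups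
  \<open>N/(N \<inter> N')\<close> and \<open>N'/(N \<inter> N')\<close>, and \<open>L\<close> is a third subgroup of the same kind, the one
  generated by \<open>x\<close>. The hypothesis on powers makes the map that identifies the images of \<open>x\<close> in
  \<open>M/N'\<close> and \<open>M/N\<close> well defined. The last conclusion is what counting needs: it confines \<open>N\<close> to
  the subgroups above \<open>N' \<inter> L\<close>, which depends on \<open>N\<close> only through \<open>L\<close>.
\<close>

lemma central_chief_factor_exchange:
  assumes N: "central_chief_factor G M N" and N': "central_chief_factor G M N'" and ne: "N \<noteq> N'"
    and x: "x \<in> M" "x \<notin> N"
    and pow: "\<And>i::int. x [^] i \<in> N' \<Longrightarrow> x [^] i \<in> N"
  defines "L \<equiv> (N \<inter> N') <#> generate G {x}"
  shows "central_chief_factor G M L" "N \<inter> N' \<subseteq> L" "x \<in> L" "N' \<inter> L \<subseteq> N"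
proof -
  have sM: "subgroup M G" and sN: "subgroup N G" and sN': "subgroup N' G"
    and NM: "N \<subset> M" and NM': "N' \<subset> M"
    using N N' by (auto simp: central_chief_factor_def)
  have max: "Q = N \<or> Q = M" if "subgroup Q G" "N \<subseteq> Q" "Q \<subseteq> M" for Q
    using N that by (simp add: central_chief_factor_def)
  have max': "Q = N' \<or> Q = M" if "subgroup Q G" "N' \<subseteq> Q" "Q \<subseteq> M" for Q
    using N' that by (simp add: central_chief_factor_def)
  have nN: "N \<lhd> G" using normal_central_chief_factor[OF N sN] NM by blast
  have nN': "N' \<lhd> G" using normal_central_chief_factor[OF N' sN'] NM' by blast
  let ?D = "N \<inter> N'"
  have nD: "?D \<lhd> G" using nN nN' by (rule normal_subgroup_intersect)
  note sD = normal_imp_subgroup[OF nD]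
  have xG: "x \<in> carrier G" using subgroup.mem_carrier[OF sM x(1)] .
  have sx: "subgroup (generate G {x}) G" using xG by (intro generate_is_subgroup) simp
  have gx: "generate G {x} = {x [^] (k :: int) | k. k \<in> UNIV}" using generate_pow[OF xG] .
  have sL: "subgroup L G" unfolding L_def using nD sx by (rule mult_norm_subgroup)
  show DL: "?D \<subseteq> L" unfolding L_def by (rule subset_set_mult_left[OF sD sx])
  have "generate G {x} \<subseteq> L" unfolding L_def by (rule subset_set_mult_right[OF sD sx])
  then show xL: "x \<in> L" by (auto intro: generate.incl)
  have pM: "x [^] (i::int) \<in> M" for i using subgroup_int_pow_closed[OF sM x(1)] .
  have LM: "L \<subseteq> M"
  proof
    fix y assume "y \<in> L"
    then obtain e i where "e \<in> ?D" "y = e \<otimes> x [^] (i::int)"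
      unfolding L_def in_set_mult_iff gx by blast
    then show "y \<in> M" using pM[of i] NM subgroup.m_closed[OF sM] by blast
  qed
  show NL: "N' \<inter> L \<subseteq> N"
  proof
    fix y assume y: "y \<in> N' \<inter> L"
    then have "y \<in> L" by blast
    then obtain e i where e: "e \<in> ?D" "y = e \<otimes> x [^] (i::int)"
      unfolding L_def in_set_mult_iff gx by blast
    have eG: "e \<in> carrier G" using e(1) subgroup.mem_carrier[OF sN] by blast
    have "x [^] i = inv e \<otimes> y" using e(2) eG xG by (simp flip: m_assoc)
    then have "x [^] i \<in> N'"
      using e(1) y subgroup.m_closed[OF sN'] subgroup.m_inv_closed[OF sN'] by auto
    then have "x [^] i \<in> N" by (rule pow)
    then show "y \<in> N" using e subgroup.m_closed[OF sN] by blast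
  qed
  have "L \<noteq> M"
  proof
    assume "L = M"
    then have "N' \<subseteq> N" using NL NM' by blast
    then show False using max'[OF sN] NM ne by blast
  qed
  moreover have "Q = L \<or> Q = M" if Q: "subgroup Q G" "L \<subseteq> Q" "Q \<subseteq> M" for Q
  proof (cases "N \<subseteq> Q")
    case True
    then show ?thesis using max[OF Q(1)] Q xL x(2) by blast
  next
    case False
    have sQN: "subgroup (Q \<inter> N) G" using Q(1) sN by (rule subgroups_Inter_pair)
    \<comment> \<open>\<open>N \<inter> N'\<close> is maximal in \<open>N\<close>, by the modular law and maximality of \<open>N'\<close> in \<open>M\<close>.\<close>
    have "Q \<inter> N \<subseteq> N'"
    proof -
      let ?R = "N' <#> (Q \<inter> N)"
      have sR: "subgroup ?R G" using nN' sQN by (rule mult_norm_subgroup)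
      have "N' \<subseteq> ?R" "Q \<inter> N \<subseteq> ?R"
        using subset_set_mult_left[OF sN' sQN] subset_set_mult_right[OF sN' sQN] by auto
      moreover have "?R \<subseteq> M"
      proof
        fix y assume "y \<in> ?R"
        then obtain a q where "a \<in> M" "q \<in> M" "y = a \<otimes> q"
          unfolding in_set_mult_iff using NM NM' by blast
        then show "y \<in> M" using subgroup.m_closed[OF sM] by simp
      qed
      moreover have "?R \<noteq> M"
      proof
        assume R: "?R = M"
        have "N \<subseteq> Q"
        proof
          fix n assume n: "n \<in> N"
          then have "n \<in> ?R" using R NM by blast
          then obtain a q where aq: "a \<in> N'" "q \<in> Q \<inter> N" "n = a \<otimes> q"
            unfolding in_set_mult_iff by blast
          have G: "a \<in> carrier G" "q \<in> carrier G"
            using aq subgroup.mem_carrier[OF sN'] subgroup.mem_carrier[OF sN] by auto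
          have "a = n \<otimes> inv q" using aq(3) G by (simp add: m_assoc)
          then have "a \<in> N" using n aq(2) subgroup.m_closed[OF sN] subgroup.m_inv_closed[OF sN] by blast
          then have "a \<in> Q" using aq(1) DL Q(2) by blast
          then show "n \<in> Q" using aq subgroup.m_closed[OF Q(1)] by blast
        qed
        then show False using False by blast
      qed
      ultimately show ?thesis using max'[OF sR] by blast
    qed
    \<comment> \<open>Since \<open>M\<close> is generated by \<open>N\<close> and \<open>x\<close>, and \<open>x \<in> Q\<close>, each element of \<open>Q\<close> is an element of
    \<open>Q \<inter> N\<close> times a power of \<open>x\<close>.\<close>
    moreover have "Q \<subseteq> L"
    proof
      fix y assume y: "y \<in> Q"
      let ?P = "N <#> generate G {x}"
      have sP: "subgroup ?P G" using nN sx by (rule mult_norm_subgroup)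
      have "N \<subseteq> ?P" "generate G {x} \<subseteq> ?P"
        using subset_set_mult_left[OF sN sx] subset_set_mult_right[OF sN sx] by auto
      moreover have "x \<in> generate G {x}" by (auto intro: generate.incl)
      moreover have "?P \<subseteq> M"
      proof
        fix z assume "z \<in> ?P"
        then obtain n i where "n \<in> M" "z = n \<otimes> x [^] (i::int)"
          unfolding in_set_mult_iff gx using NM by blast
        then show "z \<in> M" using subgroup.m_closed[OF sM _ pM] by simp
      qed
      ultimately have "?P = M" using max[OF sP] x(2) by blast
      then have "y \<in> ?P" using y Q(3) by blast
      then obtain n i where ni: "n \<in> N" "y = n \<otimes> x [^] (i::int)"
        unfolding in_set_mult_iff gx by blast
      have nG: "n \<in> carrier G" using subgroup.mem_carrier[OF sN ni(1)] .
      have pL: "x [^] i \<in> L" using subgroup_int_pow_closed[OF sL xL] .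
      have "n = y \<otimes> inv (x [^] i)" using ni(2) nG xG by (simp add: m_assoc)
      then have "n \<in> Q"
        using y pL Q(2) subgroup.m_closed[OF Q(1)] subgroup.m_inv_closed[OF Q(1)] by blast
      then have "n \<in> L" using ni(1) \<open>Q \<inter> N \<subseteq> N'\<close> DL by blast
      then show "y \<in> L" using ni(2) pL subgroup.m_closed[OF sL] by blast
    qed
    ultimately show ?thesis using Q(2) by blast
  qed
  moreover have "central_modulo G M L"
    using N N' DL unfolding central_chief_factor_def central_modulo_def by blast
  ultimately show "central_chief_factor G M L"
    using sM sL LM unfolding central_chief_factor_def by blast
qed

end

context compact_group
begin

text \<open>
  The subgroups \<open>N\<close> that do not contain \<open>x\<close> are sorted by the set of exponents \<open>i\<close> with
  \<open>x [^] i \<in> N\<close>. There are countably many classes. In each class fix one subgroup \<open>N'\<close>. Any other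
  member \<open>N\<close> lies above \<open>N' \<inter> L\<close> for some \<open>L\<close> which contains \<open>x\<close> and which is therefore counted
  by the assumption, and only finitely many subgroups lie above an open one.
\<close>

lemma countable_central_chief_factors_remove:
  assumes x: "x \<in> M"
    and cnt: "countable {N. central_chief_factor G M N \<and> openin T N \<and> insert x S \<subseteq> N}"
  shows "countable {N. central_chief_factor G M N \<and> openin T N \<and> S \<subseteq> N}"
proof -
  let ?A = "{N. central_chief_factor G M N \<and> openin T N \<and> insert x S \<subseteq> N}"
  let ?exps = "\<lambda>N. {i::int. x [^] i \<in> N}"
  define B where "B J = {N. central_chief_factor G M N \<and> openin T N \<and> S \<subseteq> N \<and> x \<notin> N \<and> ?exps N = J}" for J
  let ?\<J> = "{J :: int set. 0 \<in> J \<and> (\<forall>a\<in>J. \<forall>b\<in>J. a - b \<in> J)}"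
  have "countable (B J)" for J
  proof (cases "B J = {}")
    case False
    then obtain N' where N': "central_chief_factor G M N'" "openin T N'" "S \<subseteq> N'" "x \<notin> N'" "?exps N' = J"
      by (auto simp: B_def)
    have sN': "subgroup N' G" using N'(1) by (simp add: central_chief_factor_def)
    have "B J \<subseteq> insert N' (\<Union>L\<in>?A. {H. subgroup H G \<and> N' \<inter> L \<subseteq> H})"
    proof
      fix N assume "N \<in> B J"
      then have N: "central_chief_factor G M N" "openin T N" "S \<subseteq> N" "x \<notin> N" "?exps N = J"
        by (auto simp: B_def)
      have sN: "subgroup N G" using N(1) by (simp add: central_chief_factor_def)
      show "N \<in> insert N' (\<Union>L\<in>?A. {H. subgroup H G \<and> N' \<inter> L \<subseteq> H})"
      proof (cases "N = N'")
        case False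
        have pow: "x [^] i \<in> N" if "x [^] i \<in> N'" for i :: int
          using that N(5) N'(5) by blast
        let ?L = "(N \<inter> N') <#> generate G {x}"
        have L: "central_chief_factor G M ?L" "N \<inter> N' \<subseteq> ?L" "x \<in> ?L" "N' \<inter> ?L \<subseteq> N"
          using central_chief_factor_exchange[OF N(1) N'(1) False x N(4) pow] by blast+
        have "subgroup ?L G" using L(1) by (simp add: central_chief_factor_def)
        then have "openin T ?L"
          using openin_subgroup_supset[OF openin_Int[OF N(2) N'(2)] subgroups_Inter_pair[OF sN sN']] L(2)
          by blast
        then have "?L \<in> ?A" using L N(3) N'(3) by blast
        then show ?thesis using L(4) sN by blast
      qed simp
    qed
    moreover have "countable (\<Union>L\<in>?A. {H. subgroup H G \<and> N' \<inter> L \<subseteq> H})"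
    proof (rule countable_UN[OF cnt])
      fix L assume "L \<in> ?A"
      then have "openin T L" "subgroup L G" by (auto simp: central_chief_factor_def)
      then show "countable {H. subgroup H G \<and> N' \<inter> L \<subseteq> H}"
        using N'(2) sN' by (intro countable_finite finite_subgroups_above_open openin_Int subgroups_Inter_pair)
    qed
    ultimately show ?thesis by (meson countable_insert countable_subset)
  qed simp
  then have "countable (\<Union>J\<in>?\<J>. B J)" by (rule countable_UN[OF countable_int_subgroups])
  then have "countable (?A \<union> (\<Union>J\<in>?\<J>. B J))" using cnt by (rule_tac countable_Un)
  moreover have "{N. central_chief_factor G M N \<and> openin T N \<and> S \<subseteq> N} \<subseteq> ?A \<union> (\<Union>J\<in>?\<J>. B J)"
  proof
    fix N assume N: "N \<in> {N. central_chief_factor G M N \<and> openin T N \<and> S \<subseteq> N}"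
    show "N \<in> ?A \<union> (\<Union>J\<in>?\<J>. B J)"
    proof (cases "x \<in> N")
      case False
      have sN: "subgroup N G" and "subgroup M G" using N by (auto simp: central_chief_factor_def)
      then have xG: "x \<in> carrier G" using x subgroup.mem_carrier by metis
      have "x [^] (a - b) \<in> N" if "x [^] a \<in> N" "x [^] b \<in> N" for a b :: int
        using subgroup.m_closed[OF sN that(1) subgroup.m_inv_closed[OF sN that(2)]] xG
        by (simp add: int_pow_diff)
      moreover have "x [^] (0::int) \<in> N" using subgroup.one_closed[OF sN] by simp
      ultimately have "?exps N \<in> ?\<J>" by simp
      moreover have "N \<in> B (?exps N)" using N False by (simp add: B_def)
      ultimately show ?thesis by (intro UnI2 UN_I[of "?exps N"])
    qed (use N in blast)
  qed
  ultimately show ?thesis by (rule_tac countable_subset)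
qed

lemma countable_central_chief_factors_remove_finite:
  assumes "finite S" "S \<subseteq> M"
    and "countable {N. central_chief_factor G M N \<and> openin T N \<and> S \<subseteq> N}"
  shows "countable {N. central_chief_factor G M N \<and> openin T N}"
  using assms
proof (induction S rule: finite_induct)
  case (insert x S)
  then show ?case using countable_central_chief_factors_remove[of x M S] by simp
qed simp

end

context compact_group
begin

text \<open>
  Let \<open>t\<close> choose representatives of the cosets of \<open>M\<close>. The set \<open>S\<close> consists of the values of the
  corresponding factor set, of which there are finitely many because \<open>M\<close> has finite index. If
  \<open>N\<close> contains them, then \<open>t\<close> is multiplicative modulo \<open>N\<close>, and the elements congruent modulo
  \<open>N\<close> to a representative form a subgroup \<open>U\<close> with \<open>M U = G\<close> and \<open>U \<inter> M = N\<close>. It is normal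
  because \<open>M/N\<close> is central, and it inherits maximality from \<open>N\<close> by the modular law.
\<close>

lemma central_chief_factor_complement:
  assumes M: "M \<lhd> G" "openin T M"
  obtains S where "finite S" "S \<subseteq> M"
    "\<And>N. central_chief_factor G M N \<Longrightarrow> openin T N \<Longrightarrow> S \<subseteq> N \<Longrightarrow>
       \<exists>U. maximal_open_normal G T U \<and> U \<inter> M = N"
proof -
  note sM = normal_imp_subgroup[OF M(1)]
  have MG: "M \<subseteq> carrier G" using sM by (rule subgroup.subset)
  define t where "t g = (SOME y. y \<in> M #> g)" for g
  have tM: "t g \<in> M #> g" if "g \<in> carrier G" for g
    unfolding t_def using rcos_self[OF that sM] by (rule someI)
  have tG: "t g \<in> carrier G" if "g \<in> carrier G" for g
    using tM[OF that] r_coset_subset_G[OF MG that] by blast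
  have Mt: "M #> t g = M #> g" if "g \<in> carrier G" for g
    using repr_independence[OF tM[OF that] that sM] by simp
  have tcong: "t g = t h" if "M #> g = M #> h" for g h
    using that by (simp add: t_def)
  have tt: "t (t g) = t g" if "g \<in> carrier G" for g
    by (rule tcong[OF Mt[OF that]])
  have "t ` carrier G = (\<lambda>C. SOME y. y \<in> C) ` (rcosets M)"
    by (auto simp: t_def RCOSETS_def image_iff)
  then have fin: "finite (t ` carrier G)" using finite_rcosets_open[OF M(2) sM] by simp
  define S where "S = (\<lambda>(a, b, c). a \<otimes> b \<otimes> inv c) ` (t ` carrier G \<times> t ` carrier G \<times> t ` carrier G) \<inter> M"
  have finS: "finite S" using fin by (simp add: S_def)
  have cocycle: "t g \<otimes> t h \<otimes> inv (t (g \<otimes> h)) \<in> S" if "g \<in> carrier G" "h \<in> carrier G" for g h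
  proof -
    have gh: "g \<otimes> h \<in> carrier G" using that by simp
    have "M #> (t g \<otimes> t h) = (M #> t g) <#> (M #> t h)"
      using normal.rcos_sum[OF M(1)] tG that by simp
    also have "\<dots> = M #> (g \<otimes> h)" using Mt that normal.rcos_sum[OF M(1)] by simp
    also have "\<dots> = M #> t (g \<otimes> h)" using Mt[OF gh] by simp
    finally have "t g \<otimes> t h \<in> M #> t (g \<otimes> h)"
      using rcos_self[OF m_closed[OF tG[OF that(1)] tG[OF that(2)]] sM] by simp
    then have "t g \<otimes> t h \<otimes> inv (t (g \<otimes> h)) \<in> M"
      by (rule subgroup.rcos_module_imp[OF sM group_axioms tG[OF gh]])
    moreover have "(t g, t h, t (g \<otimes> h)) \<in> t ` carrier G \<times> t ` carrier G \<times> t ` carrier G"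
      using that by simp
    ultimately show ?thesis unfolding S_def by (metis (mono_tags, lifting) IntI case_prod_conv imageI)
  qed
  have "\<exists>U. maximal_open_normal G T U \<and> U \<inter> M = N"
    if N: "central_chief_factor G M N" "openin T N" "S \<subseteq> N" for N
  proof -
    have sN: "subgroup N G" and NM: "N \<subset> M" and cen: "central_modulo G M N"
      and max: "\<And>Q. subgroup Q G \<Longrightarrow> N \<subseteq> Q \<Longrightarrow> Q \<subseteq> M \<Longrightarrow> Q = N \<or> Q = M"
      using N(1) by (auto simp: central_chief_factor_def)
    have nN: "N \<lhd> G" using normal_central_chief_factor[OF N(1) sN] NM by blast
    have NG: "N \<subseteq> carrier G" using sN by (rule subgroup.subset)
    have coset_t: "t x = t y" if "x \<in> N #> y" "y \<in> carrier G" for x y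
    proof -
      have "x \<in> M #> y" using that(1) NM by (auto simp: r_coset_def)
      then show ?thesis using repr_independence[OF _ that(2) sM] tcong by metis
    qed
    have coset_eq: "N #> x = N #> y" if "x \<in> N #> y" "y \<in> carrier G" for x y
      using repr_independence[OF that sN] by simp
    have t_mult: "N #> (t g \<otimes> t h) = N #> t (g \<otimes> h)" if "g \<in> carrier G" "h \<in> carrier G" for g h
    proof (rule coset_eq)
      have "t g \<otimes> t h \<otimes> inv (t (g \<otimes> h)) \<in> N" using cocycle[OF that] N(3) by blast
      then show "t g \<otimes> t h \<in> N #> t (g \<otimes> h)"
        using that tG by (intro subgroup.rcos_module_rev[OF sN group_axioms]) auto
    qed (use that tG in simp)
    define U where "U = {g \<in> carrier G. N #> g = N #> t g}"
    have UG: "g \<in> carrier G" if "g \<in> U" for g using that by (simp add: U_def)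
    have tU: "t g \<in> U" if "g \<in> carrier G" for g using that tG tt by (simp add: U_def)
    have U_coset: "x \<in> U" if "x \<in> N #> u" "u \<in> U" for x u
    proof -
      have "x \<in> carrier G" using that(1) r_coset_subset_G[OF NG UG[OF that(2)]] by blast
      moreover have "N #> x = N #> u" "t x = t u"
        using that coset_eq coset_t UG by blast+
      ultimately show ?thesis using that(2) by (simp add: U_def)
    qed
    have t1: "N #> t \<one> = N"
    proof -
      have "t \<one> \<in> carrier G" using tG by simp
      moreover have "t \<one> \<otimes> t \<one> \<otimes> inv (t \<one>) \<in> N" using cocycle[of \<one> \<one>] N(3) by auto
      ultimately have "t \<one> \<in> N" by (simp add: m_assoc)
      then show ?thesis by (rule subgroup.rcos_const[OF sN group_axioms])
    qed
    have sU: "subgroup U G"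
    proof
      show "U \<subseteq> carrier G" using UG by blast
      show "\<one> \<in> U" using t1 NG by (simp add: U_def)
      fix g assume g: "g \<in> U"
      show "g \<otimes> h \<in> U" if h: "h \<in> U" for h
      proof -
        have "N #> (g \<otimes> h) = (N #> g) <#> (N #> h)"
          using normal.rcos_sum[OF nN] g h UG by simp
        also have "\<dots> = (N #> t g) <#> (N #> t h)" using g h by (simp add: U_def)
        also have "\<dots> = N #> (t g \<otimes> t h)" using normal.rcos_sum[OF nN] g h UG tG by simp
        also have "\<dots> = N #> t (g \<otimes> h)" using t_mult g h UG by simp
        finally show ?thesis using m_closed[OF UG[OF g] UG[OF h]] by (simp add: U_def)
      qed
      define n where "n = g \<otimes> t (inv g)"
      have gG: "g \<in> carrier G" using UG[OF g] .
      have tiG: "t (inv g) \<in> carrier G" using tG gG by simp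
      have nG: "n \<in> carrier G" using gG tiG by (simp add: n_def)
      have "N #> n = (N #> g) <#> (N #> t (inv g))"
        using normal.rcos_sum[OF nN] gG tiG by (simp add: n_def)
      also have "\<dots> = (N #> t g) <#> (N #> t (inv g))" using g by (simp add: U_def)
      also have "\<dots> = N #> (t g \<otimes> t (inv g))" using normal.rcos_sum[OF nN] gG tG by simp
      also have "\<dots> = N" using t_mult[of g "inv g"] gG t1 by simp
      finally have "n \<in> N" using rcos_self[OF nG sN] by simp
      then have "inv g \<otimes> n \<otimes> inv (inv g) \<in> N" using normal_invE(2)[OF nN, of "inv g" n] gG by simp
      moreover have "inv g \<otimes> n \<otimes> inv (inv g) = t (inv g) \<otimes> inv (inv g)"
        using gG tiG by (simp add: n_def flip: m_assoc)
      ultimately have "t (inv g) \<in> N #> inv g"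
        using gG tiG by (intro subgroup.rcos_module_rev[OF sN group_axioms]) auto
      then have "N #> t (inv g) = N #> inv g" using gG by (intro coset_eq) auto
      then show "inv g \<in> U" using gG by (simp add: U_def)
    qed
    have NU: "N \<subseteq> U"
    proof
      fix n assume "n \<in> N"
      then have "n \<in> N #> \<one>" using NG by simp
      then show "n \<in> U" using subgroup.one_closed[OF sU] by (rule U_coset)
    qed
    have decomp: "g \<otimes> inv (t g) \<in> M" "(g \<otimes> inv (t g)) \<otimes> t g = g" if g: "g \<in> carrier G" for g
    proof -
      have "g \<in> M #> t g" using Mt[OF g] rcos_self[OF g sM] by simp
      then show "g \<otimes> inv (t g) \<in> M" using subgroup.rcos_module_imp[OF sM group_axioms tG[OF g]] by simp
      show "(g \<otimes> inv (t g)) \<otimes> t g = g" using g tG by (simp add: m_assoc)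
    qed
    have nU: "U \<lhd> G"
    proof (rule normal_invI[OF sU])
      fix g u assume g: "g \<in> carrier G" and u: "u \<in> U"
      \<comment> \<open>Conjugation by \<open>g\<close> is conjugation by \<open>t g \<in> U\<close> followed by conjugation by an element of \<open>M\<close>,
      which is trivial modulo \<open>N\<close>.\<close>
      define m where "m = g \<otimes> inv (t g)"
      define v where "v = t g \<otimes> u \<otimes> inv (t g)"
      have m: "m \<in> M" "m \<in> carrier G" "g = m \<otimes> t g"
        using decomp[OF g] MG by (auto simp: m_def)
      have v: "v \<in> U"
        unfolding v_def using tU[OF g] u by (intro subgroup.m_closed[OF sU] subgroup.m_inv_closed[OF sU])
      have vG: "v \<in> carrier G" using UG[OF v] .
      have "inv (v \<otimes> m \<otimes> inv v \<otimes> inv m) \<in> N"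
        using cen m(1) vG subgroup.m_inv_closed[OF sN] unfolding central_modulo_def by blast
      then have "m \<otimes> v \<otimes> inv m \<otimes> inv v \<in> N"
        using m(2) vG by (simp add: inv_mult_group m_assoc)
      then have "m \<otimes> v \<otimes> inv m \<in> N #> v"
        using m(2) vG by (intro subgroup.rcos_module_rev[OF sN group_axioms]) auto
      then have "m \<otimes> v \<otimes> inv m \<in> U" using v by (rule U_coset)
      moreover have "g \<otimes> u \<otimes> inv g = m \<otimes> v \<otimes> inv m"
      proof -
        have "g \<otimes> u \<otimes> inv g = (m \<otimes> t g) \<otimes> u \<otimes> inv (m \<otimes> t g)" using m(3) by simp
        also have "\<dots> = m \<otimes> v \<otimes> inv m"
          using m(2) tG[OF g] UG[OF u] by (simp add: v_def inv_mult_group m_assoc)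
        finally show ?thesis .
      qed
      ultimately show "g \<otimes> u \<otimes> inv g \<in> U" by simp
    qed
    have UM: "U \<inter> M = N"
    proof
      show "N \<subseteq> U \<inter> M" using NU NM by blast
      show "U \<inter> M \<subseteq> N"
      proof
        fix u assume u: "u \<in> U \<inter> M"
        have uG: "u \<in> carrier G" using u UG by blast
        have "M #> u = M #> \<one>" using u subgroup.rcos_const[OF sM group_axioms] MG by simp
        then have "N #> u = N" using u t1 tcong[of u \<one>] by (simp add: U_def)
        then show "u \<in> N" using rcos_self[OF uG sN] by simp
      qed
    qed
    have "W = U \<or> W = carrier G" if W: "W \<lhd> G" "U \<subseteq> W" for W
    proof -
      note sW = normal_imp_subgroup[OF W(1)]
      have WG: "W \<subseteq> carrier G" using sW by (rule subgroup.subset)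
      have "N \<subseteq> W \<inter> M" using NU W(2) NM by blast
      then consider "W \<inter> M = N" | "W \<inter> M = M"
        using max[OF subgroups_Inter_pair[OF sW sM]] by blast
      then show ?thesis
      proof cases
        case 1
        have "W \<subseteq> U"
        proof
          fix w assume w: "w \<in> W"
          have wG: "w \<in> carrier G" using w WG by blast
          have "w \<otimes> inv (t w) \<in> W"
            using w tU[OF wG] W(2) by (intro subgroup.m_closed[OF sW] subgroup.m_inv_closed[OF sW]) auto
          then have "w \<otimes> inv (t w) \<in> U" using decomp(1)[OF wG] 1 NU by blast
          then have "(w \<otimes> inv (t w)) \<otimes> t w \<in> U"
            using tU[OF wG] by (rule subgroup.m_closed[OF sU])
          then show "w \<in> U" using decomp(2)[OF wG] by simp
        qed
        then show ?thesis using W(2) by blast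
      next
        case 2
        have "carrier G \<subseteq> W"
        proof
          fix g assume g: "g \<in> carrier G"
          have "g \<otimes> inv (t g) \<in> W" "t g \<in> W" using decomp(1)[OF g] 2 tU[OF g] W(2) by auto
          then have "(g \<otimes> inv (t g)) \<otimes> t g \<in> W" by (rule subgroup.m_closed[OF sW])
          then show "g \<in> W" using decomp(2)[OF g] by simp
        qed
        then show ?thesis using WG by blast
      qed
    qed
    moreover have "openin T U" by (rule openin_subgroup_supset[OF N(2) sN sU NU])
    moreover have "U \<noteq> carrier G" using UM NM MG by blast
    ultimately have "maximal_open_normal G T U" using nU by (simp add: maximal_open_normal_def)
    then show ?thesis using UM by blast
  qed
  moreover have "S \<subseteq> M" by (auto simp: S_def)
  ultimately show ?thesis using that finS by blast
qed

lemma countable_central_chief_factors: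
  assumes max: "countable {N. maximal_open_normal G T N}" and M: "M \<lhd> G" "openin T M"
  shows "countable {N. central_chief_factor G M N \<and> openin T N}"
proof -
  obtain S where S: "finite S" "S \<subseteq> M"
    "\<And>N. central_chief_factor G M N \<Longrightarrow> openin T N \<Longrightarrow> S \<subseteq> N \<Longrightarrow>
       \<exists>U. maximal_open_normal G T U \<and> U \<inter> M = N"
    using central_chief_factor_complement[OF M] by metis
  have "{N. central_chief_factor G M N \<and> openin T N \<and> S \<subseteq> N}
      \<subseteq> (\<lambda>U. U \<inter> M) ` {U. maximal_open_normal G T U}"
    using S(3) by blast
  then have "countable {N. central_chief_factor G M N \<and> openin T N \<and> S \<subseteq> N}"
    using max by (meson countable_image countable_subset)
  then show ?thesis by (rule countable_central_chief_factors_remove_finite[OF S(1,2)])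
qed

text \<open>
  The induction is on the number of subgroups above \<open>N\<close>, which is finite and decreases when \<open>N\<close>
  is replaced by a larger \<open>M\<close>.
\<close>

lemma countable_open_normal:
  assumes nil: "transfinite_nilpotent G T" and max: "countable {N. maximal_open_normal G T N}"
  shows "countable {N. N \<lhd> G \<and> openin T N}"
proof -
  define above where "above N = {H. subgroup H G \<and> N \<subseteq> H}" for N
  define \<O> where "\<O> n = {N. N \<lhd> G \<and> openin T N \<and> card (above N) \<le> n}" for n
  have "countable (\<O> n)" for n
  proof (induction n)
    case 0
    have "card (above N) \<noteq> 0" if "N \<lhd> G" "openin T N" for N
    proof -
      have "finite (above N)" unfolding above_def
        using that by (intro finite_subgroups_above_open) (auto simp: normal_imp_subgroup)
      moreover have "N \<in> above N" using that by (simp add: above_def normal_imp_subgroup)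
      ultimately show ?thesis by auto
    qed
    then have "\<O> 0 = {}" by (auto simp: \<O>_def)
    then show ?case by simp
  next
    case (Suc n)
    have "\<O> (Suc n) \<subseteq> insert (carrier G) (\<Union>M\<in>\<O> n. {N. central_chief_factor G M N \<and> openin T N})"
    proof
      fix N assume "N \<in> \<O> (Suc n)"
      then have N: "N \<lhd> G" "openin T N" "card (above N) \<le> Suc n" by (auto simp: \<O>_def)
      note sN = normal_imp_subgroup[OF N(1)]
      show "N \<in> insert (carrier G) (\<Union>M\<in>\<O> n. {N. central_chief_factor G M N \<and> openin T N})"
      proof (cases "N = carrier G")
        case False
        obtain M where M: "central_chief_factor G M N"
          using transfinite_nilpotent_central_chief_factor[OF nil N(1,2) False] by blast
        have sM: "subgroup M G" and NM: "N \<subset> M" using M by (auto simp: central_chief_factor_def)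
        have nM: "M \<lhd> G" using normal_central_chief_factor[OF M sM] NM by blast
        have oM: "openin T M" using openin_subgroup_supset[OF N(2) sN sM] NM by blast
        have "finite (above N)" unfolding above_def by (rule finite_subgroups_above_open[OF N(2) sN])
        moreover have "above M \<subset> above N"
        proof
          show "above M \<subseteq> above N" using NM by (auto simp: above_def)
          show "above M \<noteq> above N" using NM sN unfolding above_def by blast
        qed
        ultimately have "card (above M) < card (above N)" by (rule psubset_card_mono)
        then have "M \<in> \<O> n" using nM oM N(3) by (simp add: \<O>_def)
        then show ?thesis using M N(2) by blast
      qed simp
    qed
    moreover have "countable {N. central_chief_factor G M N \<and> openin T N}" if "M \<in> \<O> n" for M
      using that countable_central_chief_factors[OF max] by (simp add: \<O>_def)
    then have "countable (\<Union>M\<in>\<O> n. {N. central_chief_factor G M N \<and> openin T N})"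
      by (rule countable_UN[OF Suc])
    ultimately show ?case by (meson countable_insert countable_subset)
  qed
  then have "countable (\<Union>n. \<O> n)" by (intro countable_UN) auto
  moreover have "{N. N \<lhd> G \<and> openin T N} \<subseteq> (\<Union>n. \<O> n)" by (auto simp: \<O>_def)
  ultimately show ?thesis by (rule_tac countable_subset)
qed

end

section \<open>Metrizability\<close>

context profinite_group
begin

text \<open>
  Sending an element to its cosets is a continuous map into a countable product of discrete
  spaces. It is injective since open normal subgroups separate points, and it is an embedding
  since \<open>G\<close> is compact.
\<close>

lemma metrizable_if_countable_open_normal:
  assumes cnt: "countable {N. N \<lhd> G \<and> openin T N}"
  shows "metrizable_space T"
proof -
  let ?I = "{N. N \<lhd> G \<and> openin T N}"
  let ?P = "product_topology (\<lambda>N. discrete_topology (rcosets N)) ?I"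
  let ?f = "\<lambda>g. \<lambda>N\<in>?I. N #> g"
  have sub: "N \<subseteq> carrier G" if "N \<in> ?I" for N
    using that by (simp add: normal_imp_subgroup subgroup.subset)
  have cont: "continuous_map T (discrete_topology (rcosets N)) (\<lambda>g. N #> g)" if N: "N \<in> ?I" for N
    unfolding continuous_map_def
  proof (intro conjI allI impI)
    show "(\<lambda>g. N #> g) \<in> topspace T \<rightarrow> topspace (discrete_topology (rcosets N))"
      using rcosetsI[OF sub[OF N]] by auto
    fix V
    have "openin T {x \<in> topspace T. N #> x \<in> V}"
    proof (subst openin_subopen, safe)
      fix x assume x: "x \<in> topspace T" "N #> x \<in> V"
      have sN: "subgroup N G" using N by (simp add: normal_imp_subgroup)
      have xG: "x \<in> carrier G" using x(1) by simp
      have "openin T (N #> x)" using N xG by (intro openin_r_coset) auto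
      moreover have "x \<in> N #> x" using xG sN by (rule rcos_self)
      moreover have "N #> x \<subseteq> {x \<in> topspace T. N #> x \<in> V}"
      proof
        fix y assume y: "y \<in> N #> x"
        then have "N #> y = N #> x" using repr_independence[OF y xG sN] by simp
        moreover have "y \<in> carrier G" using y r_coset_subset_G[OF sub[OF N] xG] by blast
        ultimately show "y \<in> {x \<in> topspace T. N #> x \<in> V}" using x(2) by simp
      qed
      ultimately show "\<exists>W. openin T W \<and> x \<in> W \<and> W \<subseteq> {x \<in> topspace T. N #> x \<in> V}"
        by blast
    qed
    then show "openin T {x \<in> topspace T. N #> x \<in> V}" .
  qed
  have "continuous_map T ?P ?f"
    using cont by (subst continuous_map_componentwise) (simp add: image_subset_iff)
  moreover have "Hausdorff_space ?P" by (simp add: Hausdorff_space_product_topology)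
  moreover have "inj_on ?f (topspace T)"
  proof (rule inj_onI)
    fix x y assume xy: "x \<in> topspace T" "y \<in> topspace T" "?f x = ?f y"
    show "x = y"
    proof (rule ccontr)
      assume ne: "x \<noteq> y"
      have G: "x \<in> carrier G" "y \<in> carrier G" using xy by auto
      have "openin T (topspace T - {x \<otimes> inv y})"
        using openin_diff[OF openin_topspace closedin_Hausdorff_singleton[OF Hausdorff]] G by simp
      moreover have "\<one> \<noteq> x \<otimes> inv y" using ne G by (metis inv_equality inv_inv inv_closed)
      ultimately obtain N where N: "N \<lhd> G" "openin T N" "N \<subseteq> topspace T - {x \<otimes> inv y}"
        using open_normal_in_nhd_one[of "topspace T - {x \<otimes> inv y}"] by auto
      note sN = normal_imp_subgroup[OF N(1)]
      have "N #> x = N #> y" using fun_cong[OF xy(3), of N] N by simp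
      then have "x \<in> N #> y" using repr_independenceD[OF sN G(1)] by metis
      then have "x \<otimes> inv y \<in> N" by (rule subgroup.rcos_module_imp[OF sN group_axioms G(2)])
      then show False using N(3) by blast
    qed
  qed
  ultimately have "embedding_map T ?P ?f" using compact by (intro continuous_imp_embedding_map)
  then have homeo: "T homeomorphic_space subtopology ?P (?f ` topspace T)"
    by (rule embedding_map_imp_homeomorphic_space)
  have "metrizable_space ?P"
  proof -
    have "countable {N \<in> ?I. \<not> (\<exists>a. topspace (discrete_topology (rcosets N)) \<subseteq> {a})}"
      by (rule countable_subset[OF _ cnt]) blast
    then show ?thesis by (subst metrizable_space_product_topology) auto
  qed
  then have "metrizable_space (subtopology ?P (?f ` topspace T))" by (rule metrizable_space_subtopology)
  then show ?thesis using homeomorphic_metrizable_space[OF homeo] by simp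
qed

end

theorem corollary7p1:
  fixes G :: "('a, 'b) monoid_scheme" and T :: "'a topology"
  assumes "profinite_group G T"
    and "transfinite_nilpotent G T"
    and "\<And>H. subgroup H G \<Longrightarrow> T closure_of H = topspace T
            \<Longrightarrow> separable_space (subtopology T H)"
  shows "metrizable_space T"
proof -
  interpret profinite_group G T by fact
  have "countable {N. maximal_open_normal G T N}"
    using assms(3) by (rule countable_maximal_open_normal)
  then have "countable {N. N \<lhd> G \<and> openin T N}"
    by (rule countable_open_normal[OF assms(2)])
  then show ?thesis by (rule metrizable_if_countable_open_normal)
qed

end
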